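(* Let $\Omega\subset\mathbb R^2$ be a compact convex body with nonempty interior. Then there exists a constant $C_\Omega<\infty$ (depending only on $\Omega$) such that for every sufficiently large $L$ there is a finite union of line segments $S\subset\Omega$ satisfying \[ \mathcal H^1(S)=L \quad\text{and}\quad \operatorname{disc}_\Omega(S)\le C_\Omega\, L^{1/5}(\log L)^{2/5}. \]
   Context: $|\Omega|$ denotes the area of $\Omega$ and $\mathcal H^1$ the one-dimensional Hausdorff measure (length). Let $\mathcal L$ be the space of unoriented lines in $\mathbb R^2$ with the usual motion-invariant measure. For a finite union of line segments $S\subset\Omega$ with $\mathcal H^1(S)=L$, and a line $\ell$, let $\#(\ell\cap S)$ be the number of transverse intersections of $\ell$ with $S$, counted with multiplicity (the set of lines containing a segment of $S$, passing through an endpoint of a segment, or through an intersection point of two segments has measure zero and is ignored). The Buffon discrepancy is \[ \operatorname{disc}_\Omega(S)=\operatorname*{ess\,sup}_{\ell\in\mathcal L}\left|\#(\ell\cap S)-\frac{2L}{\pi|\Omega|}\,\mathcal H^1(\ell\cap\Omega)\right|. \] *)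

theory Defs
  imports "HOL-Analysis.Analysis" "HOL-Probability.Essential_Supremum"
begin

type_synonym point = "real \<times> real"

(* Lines in the plane: (theta, p) with theta in [0,pi), p real, represents
   the line {x. x \<bullet> (cos theta, sin theta) = p}.  The motion-invariant
   measure on lines is d p d theta, i.e. Lebesgue measure on [0,pi) x R. *)
definition line_dir :: "real \<Rightarrow> point" where
  "line_dir \<theta> = (cos \<theta>, sin \<theta>)"

definition line_set :: "real \<times> real \<Rightarrow> point set" where
  "line_set lp = {x. x \<bullet> line_dir (fst lp) = snd lp}"

definition line_measure :: "(real \<times> real) measure" where
  "line_measure = restrict_space lborel ({0..<pi} \<times> UNIV)"

type_synonym segs = "(point \<times> point) list"

definition seg_set :: "point \<times> point \<Rightarrow> point set" where
  "seg_set s = closed_segment (fst s) (snd s)"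

definition union_set :: "segs \<Rightarrow> point set" where
  "union_set S = (\<Union>s\<in>set S. seg_set s)"

definition total_length :: "segs \<Rightarrow> real" where
  "total_length S = (\<Sum>s\<leftarrow>S. dist (fst s) (snd s))"

(* Segments are nondegenerate and distinct segments meet in finitely many points,
   so the H^1 measure of the union equals the total length. *)
definition nonoverlapping :: "segs \<Rightarrow> bool" where
  "nonoverlapping S \<longleftrightarrow> (\<forall>i<length S. fst (S!i) \<noteq> snd (S!i)) \<and>
     (\<forall>i<length S. \<forall>j<length S. i \<noteq> j \<longrightarrow> finite (seg_set (S!i) \<inter> seg_set (S!j)))"

definition crosses :: "real \<times> real \<Rightarrow> point \<times> point \<Rightarrow> bool" where
  "crosses lp s \<longleftrightarrow>
     (fst s \<bullet> line_dir (fst lp) - snd lp) * (snd s \<bullet> line_dir (fst lp) - snd lp) < 0"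

definition cross_count :: "real \<times> real \<Rightarrow> segs \<Rightarrow> nat" where
  "cross_count lp S = length (filter (crosses lp) S)"

(* H^1(line \<inter> \<Omega>), via an arclength parametrisation of the line *)
definition chord_length :: "point set \<Rightarrow> real \<times> real \<Rightarrow> real" where
  "chord_length \<Omega> lp = measure lborel
     {t::real. snd lp *\<^sub>R line_dir (fst lp) + t *\<^sub>R (- sin (fst lp), cos (fst lp)) \<in> \<Omega>}"

definition area :: "point set \<Rightarrow> real" where
  "area \<Omega> = measure lborel \<Omega>"

definition buffon_disc :: "point set \<Rightarrow> segs \<Rightarrow> ereal" where
  "buffon_disc \<Omega> S = esssup line_measure
     (\<lambda>lp. ereal \<bar>real (cross_count lp S)
        - 2 * total_length S / (pi * area \<Omega>) * chord_length \<Omega> lp\<bar>)"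

end

theory Submission
  imports Defs "HOL-Real_Asymp.Real_Asymp"
begin

text \<open>Take \<open>M\<close> equally spaced directions and, in direction \<open>j\<close>, all chords of \<open>\<Omega>\<close> with
  offsets \<open>s (k + u\<^sub>j)\<close>, \<open>k \<in> \<int>\<close>. If a line cuts \<open>\<Omega>\<close> in the segment from \<open>a\<close> to \<open>b\<close>, the number of
  crossings with direction \<open>j\<close> is \<open>\<bar>(b - a) \<bullet> n\<^sub>j\<bar> / s\<close> plus a difference of sawtooth values at
  \<open>a \<bullet> n\<^sub>j / s - u\<^sub>j\<close> and \<open>b \<bullet> n\<^sub>j / s - u\<^sub>j\<close>. The sign of \<open>(b - a) \<bullet> n\<^sub>j\<close> changes once in \<open>j\<close>,
  so prefix sums of the sawtooth errors suffice; a greedy (derandomised Hoeffding) choice of the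
  shifts \<open>u\<^sub>j\<close> makes all of them \<open>O(sqrt (M log L))\<close> on a fine net of points. Averaging over the
  directions costs only \<open>O(1 / (s M))\<close>, which is of order \<open>L / M^2\<close> as \<open>s\<close> is about
  \<open>M * area \<Omega> / L\<close>. Balancing \<open>sqrt (M log L)\<close> against \<open>L / M^2\<close> gives
  \<open>M\<close> of order \<open>L\<^bsup>2/5\<^esup> (log L)\<^bsup>-1/5\<^esup>\<close>. Since the discrepancy is small, integrating it over all lines
  shows that the total length is nearly the intended one, and it is corrected to \<open>L\<close> by deleting
  a few long segments.\<close>

subsection \<open>Low-discrepancy shifts\<close>

text \<open>Without a careful choice of shifts, errors of order 1 per direction can add up to order
  M, and balancing M against L / M^2 would only give the exponent 1/3. The shifts make the errors
  behave like M random signs. The obstacle is that the sawtooth is discontinuous, so a bound on a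
  net does not pass to nearby points by continuity. Instead each point is bracketed, in all
  directions at once, by net values displaced by \<delta> either way; counts of grid lines are
  monotone in the end points, so the sawtooth is evaluated at bracket values only. The net is
  polynomial in L, hence the factor log L. Prefix sums enter because the index of the sign change
  depends on the line; the greedy potential is bounded after every step and so yields all prefixes
  at once. Equal spacing matters as well: the mean of |sin| over M equally spaced angles is accurate
  to order 1 / M^2, one order better than a generic Riemann sum. The intended length is put above L
  by the guaranteed length error, so that the correction never has to add anything.\<close>

lemma exp_mult_le_cosh_sinh:
  fixes l x :: real
  assumes "\<bar>x\<bar> \<le> 1"
  shows "exp (l * x) \<le> cosh l + x * sinh l"
proof -
  \<comment> \<open>\<open>exp\<close> lies below its chord over \<open>[-l, l]\<close>. The term
    linear in \<open>x\<close> is kept, since it is the one that a good shift makes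
    nonpositive.\<close>
  have "exp ((1 - (1 + x) / 2) *\<^sub>R (- l) + ((1 + x) / 2) *\<^sub>R l)
      \<le> (1 - (1 + x) / 2) * exp (- l) + ((1 + x) / 2) * exp l"
    by (rule convex_onD[OF exp_convex]) (use assms in auto)
  moreover have "(1 - (1 + x) / 2) *\<^sub>R (- l) + ((1 + x) / 2) *\<^sub>R l = l * x"
    by (simp add: field_simps)
  moreover have "(1 - (1 + x) / 2) * exp (- l) + ((1 + x) / 2) * exp l = cosh l + x * sinh l"
    by (simp add: cosh_def sinh_def field_simps)
  ultimately show ?thesis by simp
qed

lemma cosh_le_exp_half_square:
  fixes l :: real
  assumes "0 \<le> l"
  shows "cosh l \<le> exp (l\<^sup>2 / 2)"
proof -
  have g: "0 * cosh 0 - sinh 0 \<le> t * cosh t - sinh t" if "0 \<le> t" for t :: real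
    by (rule DERIV_nonneg_imp_nondecreasing[OF that])
       (auto intro!: exI derivative_eq_intros)
  have "cosh l * exp (- (l\<^sup>2 / 2)) \<le> cosh 0 * exp (- (0\<^sup>2 / 2))"
  proof (rule DERIV_nonpos_imp_nonincreasing[OF assms])
    fix t :: real assume "0 \<le> t"
    have "((\<lambda>t. cosh t * exp (- (t\<^sup>2 / 2))) has_real_derivative
        (sinh t - t * cosh t) * exp (- (t\<^sup>2 / 2))) (at t)"
      by (auto intro!: derivative_eq_intros simp: algebra_simps)
    moreover have "(sinh t - t * cosh t) * exp (- (t\<^sup>2 / 2)) \<le> 0"
      using g[OF \<open>0 \<le> t\<close>] by (intro mult_nonpos_nonneg) auto
    ultimately show "\<exists>y. ((\<lambda>t. cosh t * exp (- (t\<^sup>2 / 2))) has_real_derivative y) (at t) \<and> y \<le> 0"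
      by blast
  qed
  then show ?thesis by (simp add: exp_minus field_simps)
qed

text \<open>Method of conditional expectations: \<open>cosh\<close> penalises both signs at once,
  and \<open>mean\<close> supplies a shift for which the first-order increment of the potential
  \<open>\<Phi>\<close> is nonpositive, so each step multiplies \<open>\<Phi>\<close> by at most
  \<open>cosh l\<close>. The bound holds after every step, so one choice of shifts serves all
  prefixes.\<close>

lemma greedy_shifts:
  fixes f :: "nat \<Rightarrow> 'a \<Rightarrow> real \<Rightarrow> real"
  assumes A: "finite A" "A \<noteq> {}" and M: "0 < M"
    and bd: "\<And>j a u. a \<in> A \<Longrightarrow> \<bar>f j a u\<bar> \<le> 1"
    and mean: "\<And>j c. \<exists>u. (\<Sum>a\<in>A. c a * f j a u) \<le> 0"
  shows "\<exists>u. \<forall>n\<le>M. \<forall>a\<in>A. \<bar>\<Sum>j<n. f j a (u j)\<bar> \<le> 2 * sqrt (real M * ln (2 * real (card A)))"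
proof -
  define W where "W = ln (2 * real (card A))"
  have c1: "card A \<ge> 1" using A by (simp add: Suc_leI card_gt_0_iff)
  then have W: "W > 0" unfolding W_def by (intro ln_gt_zero) linarith
  \<comment> \<open>With \<open>M * l\<^sup>2 = W\<close> the exponent
    \<open>M * l\<^sup>2 / 2 + W\<close> is at most \<open>2 * W\<close>, and division by
    \<open>l\<close> gives the claimed bound.\<close>
  define l where "l = sqrt (W / M)"
  have l: "l > 0" using W M by (simp add: l_def)
  define \<Phi> where "\<Phi> S = (\<Sum>a\<in>A. 2 * cosh (l * S a))" for S
  have step: "\<exists>u. \<Phi> (\<lambda>a. S a + f j a u) \<le> cosh l * \<Phi> S" for j and S
  proof -
    obtain u where u: "(\<Sum>a\<in>A. (2 * sinh l * sinh (l * S a)) * f j a u) \<le> 0"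
      using mean[where j=j and c="\<lambda>a. 2 * sinh l * sinh (l * S a)"] by blast
    have "2 * cosh (l * (S a + f j a u)) \<le> cosh l * (2 * cosh (l * S a))
        + (2 * sinh l * sinh (l * S a)) * f j a u" if "a \<in> A" for a
    proof -
      let ?x = "f j a u" and ?s = "l * S a"
      have "2 * cosh (l * (S a + ?x)) = exp ?s * exp (l * ?x) + exp (- ?s) * exp (l * (- ?x))"
        by (simp add: cosh_def exp_add[symmetric] algebra_simps)
      also have "\<dots> \<le> exp ?s * (cosh l + ?x * sinh l) + exp (- ?s) * (cosh l + (- ?x) * sinh l)"
        using bd[OF that, of j u]
        by (intro add_mono mult_left_mono exp_mult_le_cosh_sinh) auto
      also have "\<dots> = cosh l * (2 * cosh ?s) + (2 * sinh l * sinh ?s) * ?x"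
        by (simp add: cosh_def[of ?s] sinh_def[of ?s] field_simps)
      finally show ?thesis .
    qed
    then have "\<Phi> (\<lambda>a. S a + f j a u) \<le> (\<Sum>a\<in>A. cosh l * (2 * cosh (l * S a))
        + (2 * sinh l * sinh (l * S a)) * f j a u)"
      unfolding \<Phi>_def by (intro sum_mono)
    also have "\<dots> \<le> cosh l * \<Phi> S"
      using u by (simp add: sum.distrib \<Phi>_def sum_distrib_left)
    finally show ?thesis by blast
  qed
  define U where "U j S = (SOME u. \<Phi> (\<lambda>a. S a + f j a u) \<le> cosh l * \<Phi> S)" for j S
  have U: "\<Phi> (\<lambda>a. S a + f j a (U j S)) \<le> cosh l * \<Phi> S" for j S
    unfolding U_def by (rule someI_ex[OF step])
  \<comment> \<open>Each shift depends on all earlier errors, so the recursion runs on the vector of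
    partial sums, and the shifts are read off afterwards.\<close>
  define S where "S = rec_nat (\<lambda>a. 0) (\<lambda>n S a. S a + f n a (U n S))"
  define u where "u j = U j (S j)" for j
  have S_eq: "S n a = (\<Sum>j<n. f j a (u j))" for n a
    by (induction n) (auto simp: S_def u_def)
  have \<Phi>_le: "\<Phi> (S n) \<le> cosh l ^ n * (2 * card A)" for n
  proof (induction n)
    case 0 then show ?case by (simp add: S_def \<Phi>_def)
  next
    case (Suc n)
    have "S (Suc n) = (\<lambda>a. S n a + f n a (U n (S n)))" by (simp add: S_def)
    then have "\<Phi> (S (Suc n)) \<le> cosh l * \<Phi> (S n)" using U by simp
    also have "\<dots> \<le> cosh l * (cosh l ^ n * (2 * card A))"
      using Suc by (intro mult_left_mono) auto
    finally show ?case by simp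
  qed
  have "\<bar>S n a\<bar> \<le> 2 * sqrt (real M * W)" if "n \<le> M" "a \<in> A" for n a
  proof -
    have "exp (l * \<bar>S n a\<bar>) \<le> exp (l * S n a) + exp (- (l * S n a))"
      using exp_gt_zero[of "l * S n a"] exp_gt_zero[of "- (l * S n a)"]
      by (cases "S n a \<ge> 0") (simp_all add: less_eq_real_def)
    also have "\<dots> = 2 * cosh (l * S n a)" by (simp add: cosh_def)
    also have "\<dots> \<le> \<Phi> (S n)" unfolding \<Phi>_def
      by (rule member_le_sum[OF that(2)]) (auto simp: A)
    also have "\<dots> \<le> cosh l ^ n * (2 * card A)" by (rule \<Phi>_le)
    also have "\<dots> \<le> cosh l ^ M * (2 * card A)"
      using that by (intro mult_right_mono power_increasing cosh_real_ge_1) auto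
    also have "\<dots> \<le> exp (l\<^sup>2 / 2) ^ M * (2 * card A)"
      using cosh_le_exp_half_square[of l] l by (intro mult_right_mono power_mono) auto
    also have "\<dots> = exp (M * (l\<^sup>2 / 2)) * (2 * card A)"
      by (simp only: exp_of_nat_mult)
    also have "\<dots> = exp (M * (l\<^sup>2 / 2) + W)"
      using c1 by (simp add: W_def exp_add)
    finally have "l * \<bar>S n a\<bar> \<le> M * (l\<^sup>2 / 2) + W" by simp
    moreover have "M * l\<^sup>2 = W" using W M by (simp add: l_def)
    ultimately have "l * \<bar>S n a\<bar> \<le> 2 * W" using W by simp
    moreover have "l * sqrt (real M * W) = W"
      using W M by (simp add: l_def real_sqrt_mult[symmetric] power2_eq_square[symmetric])
    ultimately have "l * \<bar>S n a\<bar> \<le> l * (2 * sqrt (real M * W))" by (simp add: algebra_simps)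
    then show ?thesis using l by simp
  qed
  then show ?thesis unfolding W_def S_eq by (intro exI[of _ u]) auto
qed

text \<open>Over one period of \<open>u\<close> the jump sits at \<open>u = r\<close>; the
  contributions \<open>r * r - r\<close> before it and \<open>r - r * r\<close> after it
  cancel.\<close>

lemma sawtooth_has_integral:
  fixes y :: real
  shows "((\<lambda>u. 2 * frac (y - u) - 1) has_integral 0) {0..1}"
proof -
  define r where "r = frac y"
  have r: "0 \<le> r" "r < 1" by (auto simp: r_def frac_lt_1)
  have yr: "y - r \<in> \<int>" by (simp add: r_def frac_def)
  have f1: "frac (y - u) = r - u" if "0 \<le> u" "u \<le> r" for u
  proof -
    have "y - u - (r - u) = y - r" by simp
    then have "y - u - (r - u) \<in> \<int>" using yr by (simp only:)
    moreover have "0 \<le> r - u" "r - u < 1" using r that by linarith+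
    ultimately show ?thesis by (simp only: frac_unique_iff simp_thms)
  qed
  have f2: "frac (y - u) = r - u + 1" if "r < u" "u \<le> 1" for u
  proof -
    have "y - u - (r - u + 1) = y - r - 1" by simp
    also have "\<dots> \<in> \<int>" by (rule Ints_diff[OF yr Ints_1])
    finally have "y - u - (r - u + 1) \<in> \<int>" .
    moreover have "0 \<le> r - u + 1" "r - u + 1 < 1" using r that by linarith+
    ultimately show ?thesis by (simp only: frac_unique_iff simp_thms)
  qed
  have "((\<lambda>u. 2 * (r - u) - 1) has_integral ((2*r*r - r*r - r) - (2*r*0 - 0*0 - 0))) {0..r}"
    by (rule fundamental_theorem_of_calculus[OF r(1)])
       (auto intro!: derivative_eq_intros simp flip: has_real_derivative_iff_has_vector_derivative)
  then have "((\<lambda>u. 2 * (r - u) - 1) has_integral (r * r - r)) {0..r}" by simp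
  then have i1: "((\<lambda>u. 2 * frac (y - u) - 1) has_integral (r * r - r)) {0..r}"
    by (rule has_integral_spike_finite[of "{}", rotated 2]) (simp_all add: f1)
  have "((\<lambda>u. 2 * (r - u + 1) - 1) has_integral ((2*r*1 - 1*1 + 1) - (2*r*r - r*r + r))) {r..1}"
    by (rule fundamental_theorem_of_calculus)
       (use r in \<open>auto intro!: derivative_eq_intros simp flip: has_real_derivative_iff_has_vector_derivative\<close>)
  moreover have "(2*r*1 - 1*1 + 1) - (2*r*r - r*r + r) = r - r * r" by simp
  ultimately have "((\<lambda>u. 2 * (r - u + 1) - 1) has_integral (r - r * r)) {r..1}" by (simp only:)
  \<comment> \<open>At \<open>u = r\<close> the value of \<open>frac\<close> is 0, whereas the
    formula for the second piece gives 1; a single point does not matter.\<close>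
  then have i2: "((\<lambda>u. 2 * frac (y - u) - 1) has_integral (r - r * r)) {r..1}"
    by (rule has_integral_spike_finite[of "{r}", rotated 2]) (simp_all add: f2)
  show ?thesis using has_integral_combine[OF _ _ i1 i2] r by simp
qed

text \<open>A weighted sum of sawtooth values has mean 0 over a period of \<open>u\<close>, so it
  cannot be positive everywhere. The strict inequality of integrals comes from the Lebesgue
  integral, the value 0 from the gauge integral.\<close>

lemma sawtooth_mean:
  fixes y c :: "'a \<Rightarrow> real"
  assumes "finite A"
  shows "\<exists>u. (\<Sum>a\<in>A. c a * (2 * frac (y a - u) - 1)) \<le> 0"
proof (rule ccontr)
  define g where "g u = (\<Sum>a\<in>A. c a * (2 * frac (y a - u) - 1))" for u
  assume "\<nexists>u. (\<Sum>a\<in>A. c a * (2 * frac (y a - u) - 1)) \<le> 0"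
  then have pos: "0 < g u" for u by (auto simp: g_def not_le)
  have hk: "(g has_integral 0) {0..1}"
  proof -
    have "(g has_integral (\<Sum>a\<in>A. c a * 0)) {0..1}" unfolding g_def
      by (intro has_integral_sum[OF assms] has_integral_mult_right sawtooth_has_integral)
    then show ?thesis by simp
  qed
  have [measurable]: "g \<in> borel_measurable borel"
    unfolding g_def frac_def by measurable
  have bdd: "\<bar>g u\<bar> \<le> (\<Sum>a\<in>A. \<bar>c a\<bar>)" for u
    unfolding g_def
  proof (rule order_trans[OF sum_abs sum_mono])
    fix a
    have "\<bar>2 * frac (y a - u) - 1\<bar> \<le> 1"
      using frac_ge_0[of "y a - u"] frac_lt_1[of "y a - u"] unfolding abs_le_iff by linarith
    then show "\<bar>c a * (2 * frac (y a - u) - 1)\<bar> \<le> \<bar>c a\<bar>"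
      by (simp add: abs_mult mult_left_le)
  qed
  let ?M = "restrict_space lborel {0..1::real}"
  interpret finite_measure ?M
    by (rule finite_measureI) (simp add: emeasure_restrict_space space_restrict_space)
  have "g \<in> borel_measurable ?M" by (intro measurable_restrict_space1) simp
  then have int: "integrable ?M g"
    by (intro integrable_const_bound[where B="\<Sum>a\<in>A. \<bar>c a\<bar>"]) (use bdd in auto)
  then have si: "set_integrable lborel {0..1} g"
    by (simp add: set_integrable_def integrable_restrict_space)
  have "integral\<^sup>L ?M (\<lambda>_. 0) < integral\<^sup>L ?M g"
    by (rule integral_less_AE_space)
       (use int pos in \<open>auto simp: emeasure_restrict_space space_restrict_space\<close>)
  moreover have "integral\<^sup>L ?M g = (LINT x:{0..1}|lborel. g x)"
    by (simp add: integral_restrict_space set_lebesgue_integral_def)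
  moreover have "\<dots> = integral {0..1} g"
    by (rule set_borel_integral_eq_integral(2)[OF si])
  ultimately show False using hk by (simp add: integral_unique)
qed

text \<open>Each point is rounded to a lattice of mesh \<delta>/2, and the values at the lattice
  point are moved by \<delta> up and down so as to enclose the value at \<open>z\<close> strictly in
  every direction. In the logarithm, the factor 4 counts the two displacements and the two signs of
  the error.\<close>

lemma low_discrepancy_shifts:
  fixes \<Omega> :: "point set" and \<phi> :: "nat \<Rightarrow> real" and M K :: nat
  assumes bdd: "\<And>z. z \<in> \<Omega> \<Longrightarrow> norm z \<le> R"
    and "0 < s" "0 < \<delta>" "0 < M" and K: "2 * R / \<delta> + 1 \<le> real K"
  defines "D \<equiv> sqrt (real M * ln (4 * (2 * real K + 1)\<^sup>2))"
  shows "\<exists>u. \<forall>z\<in>\<Omega>. \<exists>yl yu.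
    (\<forall>j. yl j < (z \<bullet> line_dir (\<phi> j)) / s - u j \<and> (z \<bullet> line_dir (\<phi> j)) / s - u j < yu j \<and>
         yu j - yl j = 2 * \<delta> / s) \<and>
    (\<forall>n\<le>M. \<bar>\<Sum>j<n. frac (yl j) - 1/2\<bar> \<le> D \<and> \<bar>\<Sum>j<n. frac (yu j) - 1/2\<bar> \<le> D)"
proof -
  define A where "A = {- int K..int K} \<times> {- int K..int K} \<times> {-1, 1::int}"
  define y where "y j = (\<lambda>(k::int, l::int, \<sigma>::int).
    (((\<delta> / 2 * k, \<delta> / 2 * l) \<bullet> line_dir (\<phi> j)) + \<sigma> * \<delta>) / s)" for j
  have cA: "2 * real (card A) = 4 * (2 * real K + 1)\<^sup>2"
  proof -
    have "card {- int K..int K} = 2 * K + 1" by simp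
    then have "card A = (2 * K + 1) * ((2 * K + 1) * 2)"
      by (simp add: A_def card_cartesian_product)
    then have "real (card A) = (2 * real K + 1) * ((2 * real K + 1) * 2)"
      by (simp only: of_nat_mult of_nat_add) simp
    then show ?thesis by (simp only: power2_eq_square)
  qed
  have "\<exists>u. \<forall>n\<le>M. \<forall>a\<in>A. \<bar>\<Sum>j<n. 2 * frac (y j a - u j) - 1\<bar> \<le> 2 * sqrt (real M * ln (2 * real (card A)))"
  proof (rule greedy_shifts)
    show "finite A" "A \<noteq> {}" by (auto simp: A_def)
    then show "\<exists>u. (\<Sum>a\<in>A. c a * (2 * frac (y j a - u) - 1)) \<le> 0" for j c
      by (intro sawtooth_mean)
    show "\<bar>2 * frac (y j a - u) - 1\<bar> \<le> 1" for j a u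
      using frac_ge_0[of "y j a - u"] frac_lt_1[of "y j a - u"] unfolding abs_le_iff by linarith
  qed fact
  then obtain u where u': "\<forall>n\<le>M. \<forall>a\<in>A. \<bar>\<Sum>j<n. 2 * frac (y j a - u j) - 1\<bar> \<le> 2 * D"
    unfolding cA D_def ..
  have u: "\<bar>\<Sum>j<n. 2 * frac (y j a - u j) - 1\<bar> \<le> 2 * D" if "n \<le> M" "a \<in> A" for n a
    using u' that by (simp only: Ball_def)
  show ?thesis
  proof (rule exI[of _ u], rule ballI)
    fix z assume z: "z \<in> \<Omega>"
    obtain z1 z2 where zz: "z = (z1, z2)" by (cases z)
    \<comment> \<open>Rounding down loses less than \<delta>/2 per coordinate, hence less than
      \<delta> against any unit normal. The \<open>+ 1\<close> in the assumption on \<open>K\<close>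
      makes room for the floor.\<close>
    define k l where "k = \<lfloor>2 * z1 / \<delta>\<rfloor>" and "l = \<lfloor>2 * z2 / \<delta>\<rfloor>"
    have gen: "0 \<le> t - \<delta> / 2 * \<lfloor>2 * t / \<delta>\<rfloor> \<and> t - \<delta> / 2 * \<lfloor>2 * t / \<delta>\<rfloor> < \<delta> / 2" for t
    proof -
      have "real_of_int \<lfloor>2 * t / \<delta>\<rfloor> \<le> 2 * t / \<delta>" "2 * t / \<delta> < \<lfloor>2 * t / \<delta>\<rfloor> + 1" by linarith+
      then have "\<delta> * \<lfloor>2 * t / \<delta>\<rfloor> \<le> 2 * t" "2 * t < \<delta> * (\<lfloor>2 * t / \<delta>\<rfloor> + 1)"
        using \<open>0 < \<delta>\<close> by (simp_all only: pos_le_divide_eq pos_divide_less_eq mult.commute)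
      then show ?thesis by (simp add: distrib_left)
    qed
    have rng: "\<lfloor>2 * t / \<delta>\<rfloor> \<in> {- int K..int K}" if "\<bar>t\<bar> \<le> R" for t
    proof -
      have "\<bar>2 * t / \<delta>\<bar> \<le> 2 * R / \<delta>" using that \<open>0 < \<delta>\<close> by (simp add: divide_right_mono)
      then have "\<bar>2 * t / \<delta>\<bar> + 1 \<le> real K" using K by linarith
      then have "- real K \<le> 2 * t / \<delta>" "2 * t / \<delta> \<le> real K" by linarith+
      then have "- int K \<le> \<lfloor>2 * t / \<delta>\<rfloor>" "\<lfloor>2 * t / \<delta>\<rfloor> \<le> int K" by linarith+
      then show ?thesis by simp
    qed
    have "\<bar>z1\<bar> \<le> R" "\<bar>z2\<bar> \<le> R"
      using bdd[OF z] norm_fst_le[of z1 z2] norm_snd_le[of z2 z1] by (auto simp: zz)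
    then have mem: "(k, l, \<sigma>) \<in> A" if "\<sigma> \<in> {-1, 1}" for \<sigma>
      using rng that by (auto simp: A_def k_def l_def)
    define c where "c j = (\<delta> / 2 * k, \<delta> / 2 * l) \<bullet> line_dir (\<phi> j)" for j
    have close: "\<bar>z \<bullet> line_dir (\<phi> j) - c j\<bar> < \<delta>" for j
    proof -
      define e1 e2 where "e1 = z1 - \<delta> / 2 * k" and "e2 = z2 - \<delta> / 2 * l"
      have e: "\<bar>e1\<bar> < \<delta> / 2" "\<bar>e2\<bar> < \<delta> / 2"
        using gen[of z1] gen[of z2] unfolding e1_def e2_def k_def l_def by linarith+
      have "z \<bullet> line_dir (\<phi> j) - c j = e1 * cos (\<phi> j) + e2 * sin (\<phi> j)"
        by (simp add: zz c_def line_dir_def e1_def e2_def algebra_simps)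
      also have "\<bar>\<dots>\<bar> \<le> \<bar>e1\<bar> * \<bar>cos (\<phi> j)\<bar> + \<bar>e2\<bar> * \<bar>sin (\<phi> j)\<bar>"
        by (metis abs_mult abs_triangle_ineq)
      also have "\<dots> \<le> \<bar>e1\<bar> + \<bar>e2\<bar>"
        by (intro add_mono mult_left_le) auto
      finally show ?thesis using e by linarith
    qed
    have yy: "y j (k, l, \<sigma>) = (c j + \<sigma> * \<delta>) / s" for j \<sigma> by (simp add: y_def c_def)
    have half: "\<bar>\<Sum>j<n. frac (y j a - u j) - 1/2\<bar> \<le> D" if "n \<le> M" "a \<in> A" for n a
    proof -
      have "(\<Sum>j<n. 2 * frac (y j a - u j) - 1) = 2 * (\<Sum>j<n. frac (y j a - u j) - 1/2)"
        unfolding sum_distrib_left by (rule sum.cong) auto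
      with u[OF that] show ?thesis by (simp add: abs_mult)
    qed
    define yl yu where "yl j = y j (k, l, -1) - u j" and "yu j = y j (k, l, 1) - u j" for j
    have 1: "\<forall>j. yl j < (z \<bullet> line_dir (\<phi> j)) / s - u j \<and> (z \<bullet> line_dir (\<phi> j)) / s - u j < yu j \<and>
         yu j - yl j = 2 * \<delta> / s"
    proof
      fix j
      have "c j - \<delta> < z \<bullet> line_dir (\<phi> j)" "z \<bullet> line_dir (\<phi> j) < c j + \<delta>"
        using close[of j] by linarith+
      then have "(c j - \<delta>) / s < z \<bullet> line_dir (\<phi> j) / s" "z \<bullet> line_dir (\<phi> j) / s < (c j + \<delta>) / s"
        using \<open>0 < s\<close> by (simp_all add: divide_strict_right_mono)
      moreover have "(c j + \<delta>) / s - (c j - \<delta>) / s = 2 * \<delta> / s"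
        by (simp add: diff_divide_distrib[symmetric])
      ultimately show "yl j < (z \<bullet> line_dir (\<phi> j)) / s - u j \<and> (z \<bullet> line_dir (\<phi> j)) / s - u j < yu j \<and>
         yu j - yl j = 2 * \<delta> / s"
        unfolding yl_def yu_def yy by simp
    qed
    have 2: "\<forall>n\<le>M. \<bar>\<Sum>j<n. frac (yl j) - 1/2\<bar> \<le> D \<and> \<bar>\<Sum>j<n. frac (yu j) - 1/2\<bar> \<le> D"
      unfolding yl_def yu_def using half mem by simp
    show "\<exists>yl yu.
      (\<forall>j. yl j < (z \<bullet> line_dir (\<phi> j)) / s - u j \<and> (z \<bullet> line_dir (\<phi> j)) / s - u j < yu j \<and>
         yu j - yl j = 2 * \<delta> / s) \<and>
      (\<forall>n\<le>M. \<bar>\<Sum>j<n. frac (yl j) - 1/2\<bar> \<le> D \<and> \<bar>\<Sum>j<n. frac (yu j) - 1/2\<bar> \<le> D)"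
      by (rule exI[of _ yl], rule exI[of _ yu], rule conjI[OF 1 2])
  qed
qed

subsection \<open>The sum of \<open>\<bar>sin\<bar>\<close> over equally spaced angles\<close>

lemma cos_ge_one_minus_half_square:
  fixes x :: real
  shows "1 - x\<^sup>2 / 2 \<le> cos x"
proof -
  have "\<bar>sin (x / 2)\<bar> \<le> \<bar>x / 2\<bar>" by (rule abs_sin_x_le_abs_x)
  then have "(sin (x / 2))\<^sup>2 \<le> (x / 2)\<^sup>2" by (simp only: abs_le_square_iff)
  moreover have "cos x = 1 - 2 * (sin (x / 2))\<^sup>2"
    using cos_double_sin[of "x / 2"] by simp
  ultimately show ?thesis by (simp add: power_divide)
qed

lemma sin_ge_cubic:
  fixes x :: real
  assumes "0 \<le> x"
  shows "x - x ^ 3 / 6 \<le> sin x"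
proof -
  have "sin 0 - (0 - 0 ^ 3 / 6) \<le> sin x - (x - x ^ 3 / 6)"
  proof (rule DERIV_nonneg_imp_nondecreasing[OF assms])
    fix t :: real
    have "((\<lambda>x. sin x - (x - x ^ 3 / 6)) has_real_derivative cos t - (1 - t\<^sup>2 / 2)) (at t)"
      by (auto intro!: derivative_eq_intros simp: power2_eq_square)
    then show "\<exists>y. ((\<lambda>x. sin x - (x - x ^ 3 / 6)) has_real_derivative y) (at t) \<and> 0 \<le> y"
      using cos_ge_one_minus_half_square[of t] by (intro exI conjI) auto
  qed
  then show ?thesis by simp
qed

text \<open>The factor \<open>2 * sin (h / 2)\<close> turns each term into a difference of two
  cosines, and the sum telescopes.\<close>

lemma sum_sin_arith:
  fixes \<alpha> h :: real
  shows "(\<Sum>j<n. sin (\<alpha> + real j * h)) * (2 * sin (h / 2)) = cos (\<alpha> - h / 2) - cos (\<alpha> + real n * h - h / 2)"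
proof (induction n)
  case (Suc n)
  have "sin (\<alpha> + real n * h) * (2 * sin (h / 2))
      = cos (\<alpha> + real n * h - h / 2) - cos (\<alpha> + real n * h + h / 2)"
    by (simp add: cos_add cos_diff)
  with Suc show ?case by (simp add: algebra_simps)
qed simp

text \<open>Since \<open>M * h\<close> is the period of |sin|, steps by \<open>h\<close> only
  permute the terms, and \<open>\<alpha>\<close> can be reduced to \<open>\<beta>\<close> in
  \<open>[0, h)\<close>. There all sines are nonnegative, and telescoping gives
  \<open>cos (\<beta> - x) / sin x\<close> with \<open>x = pi / (2 * M)\<close>. This lies between
  \<open>cos x / sin x\<close> and \<open>1 / sin x\<close>, both within \<open>x\<close> of
  \<open>1 / x\<close>.\<close>

lemma sum_abs_sin_bound:
  fixes \<alpha> :: real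
  assumes M: "2 \<le> M"
  shows "\<bar>(\<Sum>j<M. \<bar>sin (\<alpha> + real j * (pi / M))\<bar>) - 2 * real M / pi\<bar> \<le> 2 / M"
proof -
  define h where "h = pi / M"
  have h: "0 < h" "real M * h = pi" using M by (auto simp: h_def)
  define g where "g \<alpha> = (\<Sum>j<M. \<bar>sin (\<alpha> + real j * h)\<bar>)" for \<alpha>
  have g1: "g (\<alpha> + h) = g \<alpha>" for \<alpha>
  proof -
    have "(\<Sum>j<Suc M. \<bar>sin (\<alpha> + real j * h)\<bar>) = \<bar>sin \<alpha>\<bar> + (\<Sum>j<M. \<bar>sin (\<alpha> + real (Suc j) * h)\<bar>)"
      by (subst sum.lessThan_Suc_shift) simp
    moreover have "(\<Sum>j<Suc M. \<bar>sin (\<alpha> + real j * h)\<bar>) = g \<alpha> + \<bar>sin \<alpha>\<bar>"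
      using h by (simp add: g_def)
    moreover have "g (\<alpha> + h) = (\<Sum>j<M. \<bar>sin (\<alpha> + real (Suc j) * h)\<bar>)"
      by (simp add: g_def algebra_simps)
    ultimately show ?thesis by simp
  qed
  have gn: "g (\<alpha> + real k * h) = g \<alpha>" for k \<alpha>
  proof (induction k)
    case (Suc k)
    have "g (\<alpha> + real (Suc k) * h) = g ((\<alpha> + real k * h) + h)" by (simp add: algebra_simps)
    then show ?case using g1 Suc by simp
  qed simp
  define k where "k = \<lfloor>\<alpha> / h\<rfloor>"
  define \<beta> where "\<beta> = \<alpha> - k * h"
  have "real_of_int k \<le> \<alpha> / h" "\<alpha> / h < k + 1" by (auto simp: k_def)
  then have \<beta>: "0 \<le> \<beta>" "\<beta> < h" using h by (auto simp: \<beta>_def field_simps)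
  have gab: "g \<alpha> = g \<beta>"
  proof (cases "k \<ge> 0")
    case True
    then have "\<alpha> = \<beta> + real (nat k) * h" by (simp add: \<beta>_def)
    then show ?thesis using gn[of \<beta> "nat k"] by simp
  next
    case False
    then have "\<beta> = \<alpha> + real (nat (- k)) * h" by (simp add: \<beta>_def)
    then show ?thesis using gn[of \<alpha> "nat (- k)"] by simp
  qed
  define x where "x = h / 2"
  have x: "0 < x" "x \<le> 1" "2 * real M / pi = 1 / x" "x \<le> 2 / M"
  proof -
    have "pi / M \<le> pi / 2" using M by (intro divide_left_mono) auto
    then have "h \<le> 2" unfolding h_def using pi_less_4 by (auto intro: order_trans[where y="pi / 2"])
    then show "x \<le> 1" by (simp add: x_def)
    show "2 * real M / pi = 1 / x" using M by (simp add: x_def h_def)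
    show "x \<le> 2 / M" using pi_less_4 M by (simp add: x_def h_def field_simps)
  qed (use h in \<open>simp add: x_def\<close>)
  have sinx: "0 < sin x" using x pi_gt3 by (intro sin_gt_zero) auto
  have "g \<beta> = (\<Sum>j<M. sin (\<beta> + real j * h))"
    unfolding g_def
  proof (rule sum.cong[OF refl], rule abs_of_nonneg, rule sin_ge_zero)
    fix j assume "j \<in> {..<M}"
    then have "real j + 1 \<le> real M" by simp
    then have "(real j + 1) * h \<le> real M * h" using h by (intro mult_right_mono) auto
    then show "\<beta> + real j * h \<le> pi" using h \<beta> by (simp add: algebra_simps)
    show "0 \<le> \<beta> + real j * h" using \<beta> h by simp
  qed
  \<comment> \<open>As \<open>M * h = pi\<close>, the last cosine of the telescoped sum is
    \<open>- cos (\<beta> - x)\<close>, so the two boundary terms add up.\<close>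
  then have geq: "g \<beta> * (2 * sin x) = 2 * cos (\<beta> - x)"
    using sum_sin_arith[where n=M and \<alpha>=\<beta> and h=h] h
    by (simp add: x_def cos_add cos_diff sin_add sin_diff algebra_simps)
  then have geq': "g \<beta> = cos (\<beta> - x) / sin x" using sinx by (simp add: field_simps)
  have cosb: "cos x \<le> cos (\<beta> - x)"
  proof -
    have "cos x \<le> cos \<bar>\<beta> - x\<bar>"
      using \<beta> x pi_gt3 by (intro cos_monotone_0_pi_le) (auto simp: x_def abs_if)
    then show ?thesis by simp
  qed
  have s3: "x - x ^ 3 / 6 \<le> sin x"
    using sin_ge_cubic[of x] x by simp
  have c2: "1 - x\<^sup>2 / 2 \<le> cos x" by (rule cos_ge_one_minus_half_square)
  have up: "1 / sin x \<le> 1 / x + x"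
  proof -
    have "x ^ 5 \<le> x ^ 3" using x by (intro power_decreasing) auto
    then have "x \<le> (x - x ^ 3 / 6) * (1 + x\<^sup>2)"
      using x zero_le_power[of x 3] by (simp add: algebra_simps power_add[symmetric] power_numeral_reduce power2_eq_square) 
    also have "\<dots> \<le> sin x * (1 + x\<^sup>2)" using s3 by (intro mult_right_mono) auto
    finally show ?thesis using x sinx by (simp add: field_simps power2_eq_square)
  qed
  have lo: "1 / x - x \<le> cos x / sin x"
  proof -
    have "sin x \<le> x" using x by (intro sin_x_le_x) auto
    then have "(1 - x\<^sup>2) * sin x \<le> (1 - x\<^sup>2) * x"
      using x by (intro mult_left_mono) (auto simp: power_le_one)
    also have "\<dots> \<le> (1 - x\<^sup>2 / 2) * x" using x by (intro mult_right_mono) auto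
    also have "\<dots> \<le> cos x * x" using c2 x by (intro mult_right_mono) auto
    finally show ?thesis using x sinx by (simp add: field_simps power2_eq_square)
  qed
  have "g \<beta> \<le> 1 / sin x" unfolding geq' using sinx by (intro divide_right_mono) auto
  moreover have "cos x / sin x \<le> g \<beta>" unfolding geq' using sinx cosb by (intro divide_right_mono) auto
  ultimately have "\<bar>g \<beta> - 2 * real M / pi\<bar> \<le> 2 / M"
    using up lo x unfolding abs_le_iff by linarith
  then show ?thesis using gab unfolding g_def h_def by simp
qed

subsection \<open>Chord lengths and area\<close>

text \<open>A shear translates every horizontal slice, so Fubini reduces the claim to translation
  invariance on the real line.\<close>

lemma distr_shear_lborel:
  "distr lborel borel (\<lambda>z::real \<times> real. (fst z + c * snd z, snd z)) = lborel"
  (is "distr lborel borel ?f = lborel")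
proof (rule measure_eqI)
  fix A :: "(real \<times> real) set"
  assume "A \<in> sets (distr lborel borel ?f)"
  then have A: "A \<in> sets borel" by simp
  have f[measurable]: "?f \<in> borel_measurable borel"
    by (intro borel_measurable_continuous_onI continuous_intros)
  have B: "?f -` A \<in> sets (lborel \<Otimes>\<^sub>M lborel)" and A': "A \<in> sets (lborel \<Otimes>\<^sub>M lborel)"
    unfolding lborel_prod using measurable_sets_borel[OF f A] A by simp_all
  have "emeasure (distr lborel borel ?f) A = emeasure (lborel \<Otimes>\<^sub>M lborel) (?f -` A)"
    using A by (simp add: emeasure_distr lborel_prod)
  also have "\<dots> = (\<integral>\<^sup>+y. emeasure lborel ((\<lambda>x. (x, y)) -` (?f -` A)) \<partial>lborel)"
    by (rule lborel_pair.emeasure_pair_measure_alt2[OF B])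
  also have "\<dots> = (\<integral>\<^sup>+y. emeasure lborel ((\<lambda>x. (x, y)) -` A) \<partial>lborel)"
  proof (rule nn_integral_cong)
    fix y :: real
    have S: "(\<lambda>x. (x, y)) -` A \<in> sets borel"
      by (rule measurable_sets_borel[OF _ A]) 
         (intro borel_measurable_continuous_onI continuous_intros)
    have "(\<lambda>x. (x, y)) -` (?f -` A) = (\<lambda>x. c * y + x) -` ((\<lambda>x. (x, y)) -` A)"
      by (auto simp: add.commute)
    also have "emeasure lborel \<dots> = emeasure (distr lborel borel (\<lambda>x. c * y + x)) ((\<lambda>x. (x, y)) -` A)"
      using S by (simp add: emeasure_distr)
    also have "\<dots> = emeasure lborel ((\<lambda>x. (x, y)) -` A)"
      by (simp only: lborel_distr_plus)
    finally show "emeasure lborel ((\<lambda>x. (x, y)) -` (?f -` A)) = emeasure lborel ((\<lambda>x. (x, y)) -` A)" .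
  qed
  also have "\<dots> = emeasure (lborel \<Otimes>\<^sub>M lborel) A"
    by (rule lborel_pair.emeasure_pair_measure_alt2[OF A', symmetric])
  finally show "emeasure (distr lborel borel ?f) A = emeasure lborel A" by (simp add: lborel_prod)
qed simp

lemma distr_shear_lborel':
  "distr lborel borel (\<lambda>z::real \<times> real. (fst z, snd z + c * fst z)) = lborel"
  (is "distr lborel borel ?f = lborel")
proof (rule measure_eqI)
  fix A :: "(real \<times> real) set"
  assume "A \<in> sets (distr lborel borel ?f)"
  then have A: "A \<in> sets borel" by simp
  have f[measurable]: "?f \<in> borel_measurable borel"
    by (intro borel_measurable_continuous_onI continuous_intros)
  have B: "?f -` A \<in> sets (lborel \<Otimes>\<^sub>M lborel)" and A': "A \<in> sets (lborel \<Otimes>\<^sub>M lborel)"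
    unfolding lborel_prod using measurable_sets_borel[OF f A] A by simp_all
  have "emeasure (distr lborel borel ?f) A = emeasure (lborel \<Otimes>\<^sub>M lborel) (?f -` A)"
    using A by (simp add: emeasure_distr lborel_prod)
  also have "\<dots> = (\<integral>\<^sup>+x. emeasure lborel (Pair x -` (?f -` A)) \<partial>lborel)"
    by (rule lborel.emeasure_pair_measure_alt[OF B])
  also have "\<dots> = (\<integral>\<^sup>+x. emeasure lborel (Pair x -` A) \<partial>lborel)"
  proof (rule nn_integral_cong)
    fix x :: real
    have S: "Pair x -` A \<in> sets borel"
      by (rule measurable_sets_borel[OF _ A])
         (intro borel_measurable_continuous_onI continuous_intros)
    have "Pair x -` (?f -` A) = (\<lambda>y. c * x + y) -` (Pair x -` A)"
      by (auto simp: add.commute)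
    also have "emeasure lborel \<dots> = emeasure (distr lborel borel (\<lambda>y. c * x + y)) (Pair x -` A)"
      using S by (simp add: emeasure_distr)
    also have "\<dots> = emeasure lborel (Pair x -` A)"
      by (simp only: lborel_distr_plus)
    finally show "emeasure lborel (Pair x -` (?f -` A)) = emeasure lborel (Pair x -` A)" .
  qed
  also have "\<dots> = emeasure (lborel \<Otimes>\<^sub>M lborel) A"
    by (rule lborel.emeasure_pair_measure_alt[OF A', symmetric])
  finally show "emeasure (distr lborel borel ?f) A = emeasure lborel A" by (simp add: lborel_prod)
qed simp

text \<open>For fixed \<theta> this is the rotation by \<theta> of the point \<open>(p, t)\<close>;
  \<open>t\<close> is arclength along the line with offset \<open>p\<close>.\<close>

definition line_point :: "real \<Rightarrow> real \<Rightarrow> real \<Rightarrow> point" where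
  "line_point \<theta> p t = p *\<^sub>R line_dir \<theta> + t *\<^sub>R (- sin \<theta>, cos \<theta>)"

lemma line_point_eq: "line_point \<theta> p t = (p * cos \<theta> - t * sin \<theta>, p * sin \<theta> + t * cos \<theta>)"
  by (simp add: line_point_def line_dir_def)

lemma continuous_on_line_point [continuous_intros]:
  fixes A :: "'a::t2_space set"
  assumes "continuous_on A f" "continuous_on A g" "continuous_on A h"
  shows "continuous_on A (\<lambda>x. line_point (f x) (g x) (h x))"
  unfolding line_point_eq by (intro continuous_intros assms)

text \<open>A rotation by an angle other than \<open>\<pi>\<close> is a product of three shears.\<close>

lemma distr_rotation_lborel:
  assumes "0 \<le> \<theta>" "\<theta> < pi"
  shows "distr lborel borel (\<lambda>z. line_point \<theta> (fst z) (snd z)) = lborel"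
proof -
  \<comment> \<open>The factors are a horizontal shear by \<open>- tan (\<theta> / 2)\<close>, a
    vertical one by \<open>sin \<theta>\<close>, and the first again; \<open>e1\<close> and
    \<open>e2\<close> are the half-angle identities that match the matrix entries.\<close>
  define t where "t = - tan (\<theta> / 2)"
  define f g where "f = (\<lambda>z::real \<times> real. (fst z + t * snd z, snd z))"
    and "g = (\<lambda>z::real \<times> real. (fst z, snd z + sin \<theta> * fst z))"
  have m: "f \<in> measurable borel borel" "g \<in> measurable borel borel"
    unfolding f_def g_def by (intro borel_measurable_continuous_onI continuous_intros)+
  have c: "cos (\<theta> / 2) > 0" using assms by (intro cos_gt_zero_pi) auto
  define x y where "x = cos (\<theta> / 2)" and "y = sin (\<theta> / 2)"
  have xy: "x\<^sup>2 + y\<^sup>2 = 1" "x \<noteq> 0" using c by (auto simp: x_def y_def)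
  have d: "cos \<theta> = x\<^sup>2 - y\<^sup>2" "sin \<theta> = 2 * y * x" "t = - y / x"
    using cos_double[of "\<theta> / 2"] sin_double[of "\<theta> / 2"]
    by (auto simp: x_def y_def t_def tan_def)
  have e1: "1 + t * sin \<theta> = cos \<theta>"
    unfolding d using xy by (simp add: field_simps power2_eq_square)
  have e2: "t * (1 + cos \<theta>) = - sin \<theta>"
  proof -
    have "1 + cos \<theta> = 2 * x * x" unfolding d(1) using xy(1) by (simp add: power2_eq_square)
    then have "t * (1 + cos \<theta>) = t * (2 * x * x)" by (simp only:)
    also have "\<dots> = - sin \<theta>" unfolding d(2,3) using xy(2) by simp
    finally show ?thesis .
  qed
  have "f \<circ> g \<circ> f = (\<lambda>z. line_point \<theta> (fst z) (snd z))"
  proof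
    fix z :: "real \<times> real"
    obtain a b where z: "z = (a, b)" by (cases z)
    have "(a + t * b) + t * (b + sin \<theta> * (a + t * b)) = a * (1 + t * sin \<theta>) + b * (t * (1 + (1 + t * sin \<theta>)))"
      by (simp add: algebra_simps)
    also have "\<dots> = a * cos \<theta> - b * sin \<theta>" unfolding e1 e2 by simp
    finally have 1: "(a + t * b) + t * (b + sin \<theta> * (a + t * b)) = a * cos \<theta> - b * sin \<theta>" .
    have "b + sin \<theta> * (a + t * b) = a * sin \<theta> + b * (1 + t * sin \<theta>)"
      by (simp add: algebra_simps)
    then have 2: "b + sin \<theta> * (a + t * b) = a * sin \<theta> + b * cos \<theta>" unfolding e1 .
    show "(f \<circ> g \<circ> f) z = line_point \<theta> (fst z) (snd z)"
      using 1 2 by (simp add: z f_def g_def line_point_eq)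
  qed
  moreover have "distr lborel borel (f \<circ> g \<circ> f) = distr (distr (distr lborel borel f) borel g) borel f"
    using m by (simp add: distr_distr comp_assoc)
  ultimately show ?thesis
    using distr_shear_lborel[of t] distr_shear_lborel'[of "sin \<theta>"] by (simp add: f_def g_def)
qed

lemma chord_length_eq: "chord_length \<Omega> (\<theta>, p) = measure lborel {t. line_point \<theta> p t \<in> \<Omega>}"
  by (simp add: chord_length_def line_point_def)

lemma norm_line_point: "(norm (line_point \<theta> p t))\<^sup>2 = p\<^sup>2 + t\<^sup>2"
proof -
  have "(norm (line_point \<theta> p t))\<^sup>2 = (p * cos \<theta> - t * sin \<theta>)\<^sup>2 + (p * sin \<theta> + t * cos \<theta>)\<^sup>2"
    by (simp add: line_point_eq norm_Pair)
  also have "\<dots> = (p\<^sup>2 + t\<^sup>2) * ((cos \<theta>)\<^sup>2 + (sin \<theta>)\<^sup>2)" by algebra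
  finally show ?thesis by simp
qed

lemma abs_le_norm_line_point: "\<bar>p\<bar> \<le> norm (line_point \<theta> p t)" "\<bar>t\<bar> \<le> norm (line_point \<theta> p t)"
proof -
  have "p\<^sup>2 \<le> (norm (line_point \<theta> p t))\<^sup>2" "t\<^sup>2 \<le> (norm (line_point \<theta> p t))\<^sup>2"
    unfolding norm_line_point by simp_all
  then show "\<bar>p\<bar> \<le> norm (line_point \<theta> p t)" "\<bar>t\<bar> \<le> norm (line_point \<theta> p t)"
    by (simp_all add: power2_le_iff_abs_le)
qed

text \<open>Cavalieri's principle in rotated coordinates: the slices of the preimage
  \<open>Q\<close> are the chords of \<open>\<Omega>\<close>, and the rotation preserves
  area.\<close>

lemma has_bochner_integral_chord_length:
  assumes "0 \<le> \<theta>" "\<theta> < pi" "compact \<Omega>"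
  shows "has_bochner_integral lborel (\<lambda>p. chord_length \<Omega> (\<theta>, p)) (area \<Omega>)"
proof -
  let ?f = "\<lambda>z. line_point \<theta> (fst z) (snd z)"
  have f[measurable]: "?f \<in> borel_measurable borel"
    by (intro borel_measurable_continuous_onI continuous_intros)
  have A: "\<Omega> \<in> sets borel" using assms by (simp add: compact_imp_closed)
  define Q where "Q = ?f -` \<Omega>"
  have B: "Q \<in> sets (lborel \<Otimes>\<^sub>M lborel)"
    unfolding Q_def lborel_prod using measurable_sets_borel[OF f A] by simp
  have fin: "emeasure lborel \<Omega> < \<infinity>"
    by (rule emeasure_bounded_finite) (use assms compact_imp_bounded in auto)
  have slice: "Pair p -` Q = {t. line_point \<theta> p t \<in> \<Omega>}" for p
    by (auto simp: Q_def)
  \<comment> \<open>\<open>measure\<close> is 0 on sets of infinite measure, so finiteness of the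
    slices is needed before it can stand for \<open>emeasure\<close>.\<close>
  have finp: "emeasure lborel (Pair p -` Q) < \<infinity>" for p
  proof (rule emeasure_bounded_finite)
    obtain R where R: "\<And>z. z \<in> \<Omega> \<Longrightarrow> norm z \<le> R"
      using compact_imp_bounded[OF assms(3)] by (auto simp: bounded_iff)
    have "\<bar>t\<bar> \<le> R" if "t \<in> Pair p -` Q" for t
    proof -
      have "\<bar>t\<bar> \<le> norm (line_point \<theta> p t)" by (rule abs_le_norm_line_point)
      also have "\<dots> \<le> R" using that by (intro R) (simp add: slice)
      finally show ?thesis .
    qed
    then show "bounded (Pair p -` Q)" by (auto simp: bounded_iff intro!: exI[of _ R])
  qed
  have em: "emeasure lborel (Pair p -` Q) = ennreal (chord_length \<Omega> (\<theta>, p))" for p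
    unfolding chord_length_eq slice[symmetric]
    using finp[of p] by (intro emeasure_eq_ennreal_measure) auto
  show ?thesis
  proof (rule has_bochner_integral_nn_integral)
    have "(\<lambda>p. measure lborel (Pair p -` Q)) \<in> borel_measurable lborel"
      unfolding measure_def using lborel.measurable_emeasure_Pair[OF B] by measurable
    then show "(\<lambda>p. chord_length \<Omega> (\<theta>, p)) \<in> borel_measurable lborel"
      by (simp add: chord_length_eq slice)
    show "AE p in lborel. 0 \<le> chord_length \<Omega> (\<theta>, p)" by (simp add: chord_length_def)
    show "0 \<le> area \<Omega>" by (simp add: area_def)
    have "(\<integral>\<^sup>+p. ennreal (chord_length \<Omega> (\<theta>, p)) \<partial>lborel) = emeasure (lborel \<Otimes>\<^sub>M lborel) Q"
      unfolding em[symmetric] by (rule lborel.emeasure_pair_measure_alt[OF B, symmetric])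
    also have "\<dots> = emeasure (distr lborel borel ?f) \<Omega>"
      using A by (simp add: emeasure_distr Q_def lborel_prod)
    also have "\<dots> = ennreal (area \<Omega>)"
      unfolding distr_rotation_lborel[OF assms(1,2)] area_def
      using fin by (intro emeasure_eq_ennreal_measure) auto
    finally show "(\<integral>\<^sup>+p. ennreal (chord_length \<Omega> (\<theta>, p)) \<partial>lborel) = ennreal (area \<Omega>)" .
  qed
qed

subsection \<open>Chords of a convex body\<close>

text \<open>The tool for comparing two directions: the slope \<open>sin (\<phi> - \<theta>)\<close>
  in \<open>t\<close> fixes the order of projected end points, and its size governs the number of
  crossings.\<close>

lemma line_point_inner_line_dir:
  "line_point \<theta> p t \<bullet> line_dir \<phi> = p * cos (\<phi> - \<theta>) + t * sin (\<phi> - \<theta>)"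
  by (simp add: line_point_eq line_dir_def cos_diff sin_diff algebra_simps)

lemma line_point_inner_self [simp]: "line_point \<theta> p t \<bullet> line_dir \<theta> = p"
  by (simp add: line_point_inner_line_dir)

lemma on_line_iff: "z \<bullet> line_dir \<theta> = p \<longleftrightarrow> (\<exists>t. z = line_point \<theta> p t)"
proof
  assume *: "z \<bullet> line_dir \<theta> = p"
  obtain a b where z: "z = (a, b)" by (cases z)
  have p: "p = a * cos \<theta> + b * sin \<theta>" using * by (simp add: z line_dir_def)
  have "p * cos \<theta> - (b * cos \<theta> - a * sin \<theta>) * sin \<theta> = a * ((cos \<theta>)\<^sup>2 + (sin \<theta>)\<^sup>2)"
    "p * sin \<theta> + (b * cos \<theta> - a * sin \<theta>) * cos \<theta> = b * ((cos \<theta>)\<^sup>2 + (sin \<theta>)\<^sup>2)"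
    unfolding p by algebra+
  then show "\<exists>t. z = line_point \<theta> p t"
    by (intro exI[of _ "b * cos \<theta> - a * sin \<theta>"]) (simp add: z line_point_eq)
qed auto

lemma line_point_diff: "line_point \<theta> p t - line_point \<theta> p t' = line_point \<theta> 0 (t - t')"
  by (simp add: line_point_eq algebra_simps)

lemma dist_line_point: "dist (line_point \<theta> p t) (line_point \<theta> p t') = \<bar>t - t'\<bar>"
proof -
  have "(dist (line_point \<theta> p t) (line_point \<theta> p t'))\<^sup>2 = \<bar>t - t'\<bar>\<^sup>2"
    by (simp add: dist_norm line_point_diff norm_line_point)
  then show ?thesis by (simp only: power2_eq_iff_nonneg zero_le_dist abs_ge_zero)
qed

lemma line_point_convex_comb:
  "(1 - c) *\<^sub>R line_point \<theta> p t + c *\<^sub>R line_point \<theta> p t' = line_point \<theta> p ((1 - c) * t + c * t')"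
  by (simp add: line_point_eq algebra_simps)

lemma line_point_in_open_segment:
  assumes "t < v \<and> v < t' \<or> t' < v \<and> v < t"
  shows "line_point \<theta> p v \<in> open_segment (line_point \<theta> p t) (line_point \<theta> p t')"
proof -
  define c where "c = (v - t) / (t' - t)"
  have c: "0 < c" "c < 1" using assms by (auto simp: c_def divide_simps)
  have "c * (t' - t) = v - t" using assms by (auto simp: c_def)
  then have "(1 - c) * t + c * t' = v" by (simp add: algebra_simps)
  then have "line_point \<theta> p v = (1 - c) *\<^sub>R line_point \<theta> p t + c *\<^sub>R line_point \<theta> p t'"
    by (simp add: line_point_convex_comb)
  moreover have "line_point \<theta> p t \<noteq> line_point \<theta> p t'"
    using dist_line_point[of \<theta> p t t'] assms by auto
  ultimately show ?thesis using c by (auto simp: in_segment)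
qed

lemma crosses_imp_meets:
  assumes "crosses lp s"
  shows "\<exists>z\<in>seg_set s. z \<bullet> line_dir (fst lp) = snd lp"
proof -
  define x y where "x = fst s \<bullet> line_dir (fst lp) - snd lp" and "y = snd s \<bullet> line_dir (fst lp) - snd lp"
  have xy: "x * y < 0" using assms by (simp add: crosses_def x_def y_def)
  define c where "c = x / (x - y)"
  have c: "0 \<le> c" "c \<le> 1" "(1 - c) * x + c * y = 0"
    using xy by (auto simp: c_def mult_less_0_iff divide_simps algebra_simps)
  define z where "z = (1 - c) *\<^sub>R fst s + c *\<^sub>R snd s"
  have "z \<bullet> line_dir (fst lp) - snd lp = (1 - c) * x + c * y"
    by (simp add: z_def x_def y_def inner_add_left algebra_simps)
  with c show ?thesis by (intro bexI[of _ z]) (auto simp: z_def seg_set_def in_segment)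
qed

text \<open>Separates off the lines that touch \<open>\<Omega>\<close> in the boundary only. Their
  chord may be a point or an edge, but they form a null set.\<close>

definition meets_interior :: "point set \<Rightarrow> real \<Rightarrow> real \<Rightarrow> bool" where
  "meets_interior \<Omega> \<theta> p \<longleftrightarrow> (\<exists>z\<in>interior \<Omega>. z \<bullet> line_dir \<theta> = p)"

definition chord_lo :: "point set \<Rightarrow> real \<Rightarrow> real \<Rightarrow> real" where
  "chord_lo \<Omega> \<theta> p = Inf {t. line_point \<theta> p t \<in> \<Omega>}"

definition chord_hi :: "point set \<Rightarrow> real \<Rightarrow> real \<Rightarrow> real" where
  "chord_hi \<Omega> \<theta> p = Sup {t. line_point \<theta> p t \<in> \<Omega>}"

definition chord :: "point set \<Rightarrow> real \<Rightarrow> real \<Rightarrow> point \<times> point" where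
  "chord \<Omega> \<theta> p = (line_point \<theta> p (chord_lo \<Omega> \<theta> p), line_point \<theta> p (chord_hi \<Omega> \<theta> p))"

locale convex_body =
  fixes \<Omega> :: "point set" and R :: real
  assumes compact: "compact \<Omega>" and convex: "convex \<Omega>" and interior: "interior \<Omega> \<noteq> {}"
    and norm_le: "\<And>z. z \<in> \<Omega> \<Longrightarrow> norm z \<le> R"
begin

lemma R_nonneg: "0 \<le> R"
  using interior interior_subset norm_le norm_ge_zero order_trans by (metis ex_in_conv in_mono)

lemma meets_interior_imp: "meets_interior \<Omega> \<theta> p \<Longrightarrow> \<exists>z\<in>\<Omega>. z \<bullet> line_dir \<theta> = p"
  using interior_subset by (auto simp: meets_interior_def)

lemma offset_le:
  assumes "z \<in> \<Omega>" "z \<bullet> line_dir \<theta> = p"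
  shows "\<bar>p\<bar> \<le> R"
  using assms abs_le_norm_line_point(1)[of p \<theta>] norm_le[OF assms(1)] unfolding on_line_iff
  by (meson order_trans)

lemma slice_eq:
  assumes "\<exists>z\<in>\<Omega>. z \<bullet> line_dir \<theta> = p"
  shows "{t. line_point \<theta> p t \<in> \<Omega>} = {chord_lo \<Omega> \<theta> p..chord_hi \<Omega> \<theta> p}"
    and "chord_lo \<Omega> \<theta> p \<le> chord_hi \<Omega> \<theta> p"
proof -
  let ?T = "{t. line_point \<theta> p t \<in> \<Omega>}"
  have ne: "?T \<noteq> {}" using assms by (auto simp: on_line_iff)
  have "closed ?T"
    using closed_vimage[OF compact_imp_closed[OF compact]
        continuous_on_line_point[OF continuous_on_const continuous_on_const continuous_on_id], of \<theta> p]
    by (simp add: vimage_def)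
  moreover have "\<bar>t\<bar> \<le> R" if "t \<in> ?T" for t
    using order_trans[OF abs_le_norm_line_point(2) norm_le] that by blast
  then have "bounded ?T" unfolding bounded_iff by auto
  ultimately have "compact ?T" by (simp add: compact_eq_bounded_closed)
  moreover have "convex ?T"
    unfolding convex_alt
    using convexD_alt[OF convex] by (auto simp: line_point_convex_comb[symmetric])
  then have "connected ?T" by (rule convex_connected)
  ultimately obtain a b where ab: "?T = {a..b}" using connected_compact_interval_1 by blast
  then show "?T = {chord_lo \<Omega> \<theta> p..chord_hi \<Omega> \<theta> p}" "chord_lo \<Omega> \<theta> p \<le> chord_hi \<Omega> \<theta> p"
    using ne by (auto simp: chord_lo_def chord_hi_def)
qed

lemma chord_length_meets:
  assumes "\<exists>z\<in>\<Omega>. z \<bullet> line_dir \<theta> = p"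
  shows "chord_length \<Omega> (\<theta>, p) = chord_hi \<Omega> \<theta> p - chord_lo \<Omega> \<theta> p"
  using slice_eq[OF assms] by (simp add: chord_length_eq)

lemma chord_length_no_meet:
  assumes "\<not> (\<exists>z\<in>\<Omega>. z \<bullet> line_dir \<theta> = p)"
  shows "chord_length \<Omega> (\<theta>, p) = 0"
proof -
  have "{t. line_point \<theta> p t \<in> \<Omega>} = {}" using assms line_point_inner_self by blast
  then show ?thesis by (simp add: chord_length_eq)
qed

lemma line_point_in_iff:
  assumes "\<exists>z\<in>\<Omega>. z \<bullet> line_dir \<theta> = p"
  shows "line_point \<theta> p t \<in> \<Omega> \<longleftrightarrow> chord_lo \<Omega> \<theta> p \<le> t \<and> t \<le> chord_hi \<Omega> \<theta> p"
proof -
  have "line_point \<theta> p t \<in> \<Omega> \<longleftrightarrow> t \<in> {t. line_point \<theta> p t \<in> \<Omega>}" by simp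
  then show ?thesis by (simp only: slice_eq(1)[OF assms] atLeastAtMost_iff)
qed

lemma chord_length_le: "chord_length \<Omega> (\<theta>, p) \<le> 2 * R"
proof (cases "\<exists>z\<in>\<Omega>. z \<bullet> line_dir \<theta> = p")
  case True
  have "dist (line_point \<theta> p (chord_hi \<Omega> \<theta> p)) (line_point \<theta> p (chord_lo \<Omega> \<theta> p))
      \<le> norm (line_point \<theta> p (chord_hi \<Omega> \<theta> p)) + norm (line_point \<theta> p (chord_lo \<Omega> \<theta> p))"
    by (simp add: dist_norm norm_triangle_ineq4)
  also have "\<dots> \<le> R + R"
    using slice_eq(2)[OF True] by (intro add_mono norm_le) (auto simp: line_point_in_iff[OF True])
  finally show ?thesis by (simp add: dist_line_point chord_length_meets[OF True])
next
  case False
  then show ?thesis using R_nonneg chord_length_no_meet[of \<theta> p] by auto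
qed

lemma chord_in:
  assumes "\<exists>z\<in>\<Omega>. z \<bullet> line_dir \<theta> = p"
  shows "seg_set (chord \<Omega> \<theta> p) \<subseteq> \<Omega>"
  unfolding seg_set_def chord_def fst_conv snd_conv
  using slice_eq(2)[OF assms]
  by (intro closed_segment_subset convex) (auto simp: line_point_in_iff[OF assms])

lemma on_chord_line:
  assumes "z \<in> seg_set (chord \<Omega> \<theta> p)"
  shows "z \<bullet> line_dir \<theta> = p"
  using assms by (auto simp: seg_set_def chord_def in_segment line_point_convex_comb)

lemma interior_chord:
  assumes "line_point \<theta> p t \<in> interior \<Omega>"
  shows "chord_lo \<Omega> \<theta> p < t" "t < chord_hi \<Omega> \<theta> p"
proof -
  have m: "\<exists>z\<in>\<Omega>. z \<bullet> line_dir \<theta> = p"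
    using assms interior_subset by (intro bexI[of _ "line_point \<theta> p t"]) auto
  obtain e where e: "e > 0" "ball (line_point \<theta> p t) e \<subseteq> \<Omega>" using assms by (auto simp: mem_interior)
  have "line_point \<theta> p (t - e / 2) \<in> \<Omega>" "line_point \<theta> p (t + e / 2) \<in> \<Omega>"
    using e(1) by (auto intro!: subsetD[OF e(2)] simp: dist_line_point)
  then show "chord_lo \<Omega> \<theta> p < t" "t < chord_hi \<Omega> \<theta> p"
    using e(1) by (auto simp: line_point_in_iff[OF m])
qed

lemma meets_interior_chord_less:
  assumes "meets_interior \<Omega> \<theta> p"
  shows "chord_lo \<Omega> \<theta> p < chord_hi \<Omega> \<theta> p"
  using assms interior_chord less_trans unfolding meets_interior_def on_line_iff by metis

lemma chord_nondegenerate: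
  assumes "meets_interior \<Omega> \<theta> p"
  shows "fst (chord \<Omega> \<theta> p) \<noteq> snd (chord \<Omega> \<theta> p)"
  using meets_interior_chord_less[OF assms]
    dist_line_point[of \<theta> p "chord_lo \<Omega> \<theta> p" "chord_hi \<Omega> \<theta> p"]
  by (auto simp: chord_def)

text \<open>The open segment from an interior point to any point of \<open>\<Omega>\<close> stays in
  the interior. Using it for points \<open>a\<close> and \<open>b\<close> of extreme offset reaches
  every offset strictly between the extremes, so at most the two extremes are exceptional.\<close>

lemma finite_support_lines:
  "finite {p. (\<exists>z\<in>\<Omega>. z \<bullet> line_dir \<theta> = p) \<and> \<not> meets_interior \<Omega> \<theta> p}"
proof -
  obtain i where i: "i \<in> interior \<Omega>" using interior by blast
  then have ne: "\<Omega> \<noteq> {}" using interior_subset by blast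
  have cont: "continuous_on \<Omega> (\<lambda>z. z \<bullet> line_dir \<theta>)" by (intro continuous_intros)
  obtain a where a: "a \<in> \<Omega>" "\<And>z. z \<in> \<Omega> \<Longrightarrow> a \<bullet> line_dir \<theta> \<le> z \<bullet> line_dir \<theta>"
    using continuous_attains_inf[OF compact ne cont] by blast
  obtain b where b: "b \<in> \<Omega>" "\<And>z. z \<in> \<Omega> \<Longrightarrow> z \<bullet> line_dir \<theta> \<le> b \<bullet> line_dir \<theta>"
    using continuous_attains_sup[OF compact ne cont] by blast
  have seg: "meets_interior \<Omega> \<theta> p"
    if "e \<in> \<Omega>" and between: "i \<bullet> line_dir \<theta> < p \<and> p < e \<bullet> line_dir \<theta> \<or> e \<bullet> line_dir \<theta> < p \<and> p < i \<bullet> line_dir \<theta>"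
    for e p
  proof -
    define x y where "x = i \<bullet> line_dir \<theta>" and "y = e \<bullet> line_dir \<theta>"
    define c where "c = (p - x) / (y - x)"
    have c: "0 < c" "c < 1" using between by (auto simp: c_def x_def[symmetric] y_def[symmetric] divide_simps)
    have "c * (y - x) = p - x" using between by (auto simp: c_def x_def[symmetric] y_def[symmetric])
    then have eq: "(1 - c) * x + c * y = p" by (simp add: algebra_simps)
    define z where "z = (1 - c) *\<^sub>R i + c *\<^sub>R e"
    have "i \<noteq> e" using between by auto
    then have "z \<in> open_segment i e" using c by (auto simp: in_segment z_def)
    moreover have "open_segment i e \<subseteq> interior \<Omega>"
      using that(1) closure_subset by (intro in_interior_closure_convex_segment convex i) auto
    moreover have "z \<bullet> line_dir \<theta> = p" using eq by (simp add: z_def x_def y_def inner_add_left)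
    ultimately show ?thesis unfolding meets_interior_def by blast
  qed
  have "p \<in> {a \<bullet> line_dir \<theta>, b \<bullet> line_dir \<theta>}"
    if "\<exists>z\<in>\<Omega>. z \<bullet> line_dir \<theta> = p" "\<not> meets_interior \<Omega> \<theta> p" for p
  proof (rule ccontr)
    assume "p \<notin> {a \<bullet> line_dir \<theta>, b \<bullet> line_dir \<theta>}"
    then have "a \<bullet> line_dir \<theta> < p" "p < b \<bullet> line_dir \<theta>" using a b that(1) by force+
    moreover have "i \<bullet> line_dir \<theta> \<noteq> p" using that(2) i by (auto simp: meets_interior_def)
    ultimately show False using seg[OF a(1), of p] seg[OF b(1), of p] that(2) by force
  qed
  then show ?thesis by (auto intro: finite_subset[of _ "{a \<bullet> line_dir \<theta>, b \<bullet> line_dir \<theta>}"])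
qed

section \<open>The chords of a second direction that a fixed line crosses\<close>

context
  fixes \<theta> p :: real
  assumes meets: "meets_interior \<Omega> \<theta> p"
begin

definition "end1 = line_point \<theta> p (chord_lo \<Omega> \<theta> p)"
definition "end2 = line_point \<theta> p (chord_hi \<Omega> \<theta> p)"

lemma end_in: "end1 \<in> \<Omega>" "end2 \<in> \<Omega>"
  using meets_interior_imp[OF meets] meets_interior_chord_less[OF meets]
  by (auto simp: end1_def end2_def line_point_in_iff)

text \<open>The sine serves twice: its absolute values, summed over the directions, produce the main
  term, and its sign changes only once over the directions in \<open>[0, pi)\<close>.\<close>

lemma end_diff:
  "end2 \<bullet> line_dir \<phi> - end1 \<bullet> line_dir \<phi> = chord_length \<Omega> (\<theta>, p) * sin (\<phi> - \<theta>)"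
  by (simp add: end1_def end2_def line_point_inner_line_dir chord_length_meets[OF meets_interior_imp[OF meets]] algebra_simps)

text \<open>The crossing point lies on both lines and in \<open>\<Omega>\<close>, hence between
  \<open>end1\<close> and \<open>end2\<close>, where the offset in direction \<phi> is affine.
  Equality can occur when the chord is an edge of \<open>\<Omega>\<close>.\<close>

lemma crosses_chord_imp_between:
  assumes "\<exists>z\<in>\<Omega>. z \<bullet> line_dir \<phi> = q" "crosses (\<theta>, p) (chord \<Omega> \<phi> q)"
  shows "min (end1 \<bullet> line_dir \<phi>) (end2 \<bullet> line_dir \<phi>) \<le> q"
    and "q \<le> max (end1 \<bullet> line_dir \<phi>) (end2 \<bullet> line_dir \<phi>)"
proof -
  obtain z where z: "z \<in> seg_set (chord \<Omega> \<phi> q)" "z \<bullet> line_dir \<theta> = p"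
    using crosses_imp_meets[OF assms(2)] by auto
  then have zq: "z \<bullet> line_dir \<phi> = q" and zO: "z \<in> \<Omega>"
    using on_chord_line chord_in[OF assms(1)] by auto
  obtain t where t: "z = line_point \<theta> p t" using z(2) on_line_iff by blast
  have "chord_lo \<Omega> \<theta> p \<le> t" "t \<le> chord_hi \<Omega> \<theta> p"
    using zO meets_interior_imp[OF meets] by (auto simp: t line_point_in_iff)
  then have "min (chord_lo \<Omega> \<theta> p * x) (chord_hi \<Omega> \<theta> p * x) \<le> t * x \<and> t * x \<le> max (chord_lo \<Omega> \<theta> p * x) (chord_hi \<Omega> \<theta> p * x)" for x
    by (cases "x \<ge> 0") (auto simp: min_def max_def intro: mult_right_mono mult_right_mono_neg)
  from this[of "sin (\<phi> - \<theta>)"]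
  show "min (end1 \<bullet> line_dir \<phi>) (end2 \<bullet> line_dir \<phi>) \<le> q"
    "q \<le> max (end1 \<bullet> line_dir \<phi>) (end2 \<bullet> line_dir \<phi>)"
    unfolding zq[symmetric] t end1_def end2_def line_point_inner_line_dir by (auto simp: min_def max_def split: if_splits)
qed

text \<open>The point of the line with offset \<open>q\<close> is strictly between the two ends,
  hence interior by convexity. So the chord in direction \<phi> extends to both sides of it, and the
  crossing is transverse because the sine is nonzero.\<close>

lemma between_imp_crosses_chord:
  assumes "min (end1 \<bullet> line_dir \<phi>) (end2 \<bullet> line_dir \<phi>) < q"
    and "q < max (end1 \<bullet> line_dir \<phi>) (end2 \<bullet> line_dir \<phi>)"
  shows "meets_interior \<Omega> \<phi> q" "crosses (\<theta>, p) (chord \<Omega> \<phi> q)"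
proof -
  let ?lo = "chord_lo \<Omega> \<theta> p" and ?hi = "chord_hi \<Omega> \<theta> p"
  define x where "x = sin (\<phi> - \<theta>)"
  have ends: "end1 \<bullet> line_dir \<phi> = p * cos (\<phi> - \<theta>) + ?lo * x" "end2 \<bullet> line_dir \<phi> = p * cos (\<phi> - \<theta>) + ?hi * x"
    by (simp_all add: end1_def end2_def line_point_inner_line_dir x_def)
  have lh: "?lo < ?hi" by (rule meets_interior_chord_less[OF meets])
  have x: "x \<noteq> 0" using assms by (auto simp: ends)
  define t where "t = (q - p * cos (\<phi> - \<theta>)) / x"
  have qt: "q = p * cos (\<phi> - \<theta>) + t * x" using x by (simp add: t_def)
  have t: "?lo < t" "t < ?hi"
  proof -
    consider "x > 0" | "x < 0" using x by linarith
    then have "?lo < t \<and> t < ?hi"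
    proof cases
      case 1
      then have "?lo * x < ?hi * x" using lh by simp
      then show ?thesis using assms 1 unfolding ends qt by (simp add: min_def max_def split: if_splits)
    next
      case 2
      then have "?hi * x < ?lo * x" using lh by simp
      then show ?thesis using assms 2 unfolding ends qt by (simp add: min_def max_def split: if_splits)
    qed
    then show "?lo < t" "t < ?hi" by auto
  qed
  define z where "z = line_point \<theta> p t"
  have zq: "z \<bullet> line_dir \<phi> = q" by (simp add: z_def line_point_inner_line_dir qt x_def)
  have z: "z \<in> interior \<Omega>"
  proof -
    obtain v where v: "line_point \<theta> p v \<in> interior \<Omega>"
      using meets by (auto simp: meets_interior_def on_line_iff)
    consider "t = v" | "?lo < t \<and> t < v" | "v < t \<and> t < ?hi" using t by linarith
    then show ?thesis
    proof cases
      case 1 then show ?thesis using v by (simp add: z_def)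
    next
      case 2
      then have "z \<in> open_segment (line_point \<theta> p v) end1"
        unfolding z_def end1_def by (intro line_point_in_open_segment) auto
      then show ?thesis
        using in_interior_closure_convex_segment[OF convex v] end_in(1) closure_subset by blast
    next
      case 3
      then have "z \<in> open_segment (line_point \<theta> p v) end2"
        unfolding z_def end2_def by (intro line_point_in_open_segment) auto
      then show ?thesis
        using in_interior_closure_convex_segment[OF convex v] end_in(2) closure_subset by blast
    qed
  qed
  then show "meets_interior \<Omega> \<phi> q" using zq by (auto simp: meets_interior_def)
  obtain v where v: "z = line_point \<phi> q v" using zq on_line_iff by blast
  have *: "line_point \<phi> q r \<bullet> line_dir \<theta> - p = (r - v) * sin (\<theta> - \<phi>)" for r
  proof -
    have "z \<bullet> line_dir \<theta> = p" by (simp add: z_def)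
    then show ?thesis unfolding v line_point_inner_line_dir by (simp add: algebra_simps)
  qed
  have "chord_lo \<Omega> \<phi> q < v" "v < chord_hi \<Omega> \<phi> q"
    using interior_chord z unfolding v by auto
  then have "(chord_lo \<Omega> \<phi> q - v) * (chord_hi \<Omega> \<phi> q - v) < 0" by (simp add: mult_neg_pos)
  moreover have "sin (\<theta> - \<phi>) \<noteq> 0" using x sin_minus[of "\<theta> - \<phi>"] by (auto simp: x_def)
  ultimately have "((chord_lo \<Omega> \<phi> q - v) * (chord_hi \<Omega> \<phi> q - v)) * (sin (\<theta> - \<phi>))\<^sup>2 < 0"
    by (simp add: mult_neg_pos)
  then show "crosses (\<theta>, p) (chord \<Omega> \<phi> q)"
    by (simp add: crosses_def chord_def * power2_eq_square mult_ac)
qed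

end

end

subsection \<open>Crossings with a grid of chords\<close>

text \<open>Scaling by \<open>s\<close> turns grid lines into integers. \<open>C\<close> is known
  only up to its end points, but the brackets are strict, so floors at bracket ends bound the count
  in either case.\<close>

lemma card_between_bounds:
  fixes C :: "int set" and s x y v lx ux ly uy :: real
  assumes s: "0 < s" and xy: "x \<le> y"
    and C1: "\<And>k. x < s * (of_int k + v) \<Longrightarrow> s * (of_int k + v) < y \<Longrightarrow> k \<in> C"
    and C2: "\<And>k. k \<in> C \<Longrightarrow> x \<le> s * (of_int k + v) \<and> s * (of_int k + v) \<le> y"
    and lx: "lx < x / s - v" "x / s - v < ux" and ly: "ly < y / s - v" "y / s - v < uy"
  shows "\<lfloor>ly\<rfloor> - \<lfloor>ux\<rfloor> \<le> int (card C)" "int (card C) \<le> \<lfloor>uy\<rfloor> - \<lfloor>lx\<rfloor>"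
proof -
  have iff1: "x < s * (k + v) \<longleftrightarrow> x / s - v < k" "s * (k + v) < y \<longleftrightarrow> k < y / s - v"
    "x \<le> s * (k + v) \<longleftrightarrow> x / s - v \<le> k" "s * (k + v) \<le> y \<longleftrightarrow> k \<le> y / s - v" for k :: real
    using s by (auto simp: field_simps)
  have sub: "C \<subseteq> {\<lfloor>lx\<rfloor> + 1..\<lfloor>uy\<rfloor>}"
  proof
    fix k assume "k \<in> C"
    then have "x / s - v \<le> of_int k" "of_int k \<le> y / s - v" using C2 iff1 by auto
    then have "lx < of_int k" "of_int k \<le> uy" using lx ly by linarith+
    then show "k \<in> {\<lfloor>lx\<rfloor> + 1..\<lfloor>uy\<rfloor>}" by (simp add: le_floor_iff) linarith
  qed
  have "{\<lfloor>ux\<rfloor> + 1..\<lfloor>ly\<rfloor>} \<subseteq> C"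
  proof
    fix k assume k: "k \<in> {\<lfloor>ux\<rfloor> + 1..\<lfloor>ly\<rfloor>}"
    then have "ux < of_int k" "of_int k \<le> ly" by (auto simp: le_floor_iff) linarith
    then have "x / s - v < of_int k" "of_int k < y / s - v" using lx ly by linarith+
    then show "k \<in> C" using C1 iff1 by auto
  qed
  then have "card {\<lfloor>ux\<rfloor> + 1..\<lfloor>ly\<rfloor>} \<le> card C"
    by (rule card_mono[OF finite_subset[OF sub], rotated]) simp
  then show "\<lfloor>ly\<rfloor> - \<lfloor>ux\<rfloor> \<le> int (card C)" by simp
  \<comment> \<open>Gives \<open>\<lfloor>lx\<rfloor> \<le> \<lfloor>uy\<rfloor>\<close>, without
    which the cardinality of the integer interval would be truncated at 0.\<close>
  have "x / s \<le> y / s" using s xy by (simp add: divide_right_mono)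
  then have "\<lfloor>lx\<rfloor> \<le> \<lfloor>uy\<rfloor>" using lx ly by (intro floor_mono) linarith
  moreover have "card C \<le> card {\<lfloor>lx\<rfloor> + 1..\<lfloor>uy\<rfloor>}" by (rule card_mono[OF _ sub]) simp
  ultimately show "int (card C) \<le> \<lfloor>uy\<rfloor> - \<lfloor>lx\<rfloor>" by simp
qed

lemma abs_sum_atLeastLessThan_le:
  fixes f :: "nat \<Rightarrow> real"
  assumes "\<And>n. n \<le> M \<Longrightarrow> \<bar>sum f {..<n}\<bar> \<le> D" "n \<le> M"
  shows "\<bar>sum f {n..<M}\<bar> \<le> 2 * D"
proof -
  have "sum f {..<M} = sum f {..<n} + sum f {n..<M}"
    using assms(2) by (metis atLeast0LessThan bot_nat_0.extremum sum.atLeastLessThan_concat)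
  then show ?thesis using assms(1)[of M] assms(1)[OF assms(2)] by linarith
qed

text \<open>Writing \<open>\<lfloor>x\<rfloor> = x - \<psi> x - 1/2\<close> leaves sawtooth sums
  before and after \<open>n0\<close>. Two prefix sums cost \<open>2 * D\<close>; two tails, each a
  difference of prefix sums, cost \<open>4 * D\<close>. Moving an end point to its bracket costs at
  most \<open>\<epsilon>\<close>, twice in each of the \<open>M\<close> directions.\<close>

lemma sum_counts_bound:
  fixes ea eb v la ua lb ub :: "nat \<Rightarrow> real" and N :: "nat \<Rightarrow> nat"
  assumes s: "0 < s" and n0: "n0 \<le> M"
    and a: "\<And>j. la j < ea j / s - v j \<and> ea j / s - v j < ua j \<and> ua j - la j = \<epsilon>"
    and b: "\<And>j. lb j < eb j / s - v j \<and> eb j / s - v j < ub j \<and> ub j - lb j = \<epsilon>"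
    and D: "\<And>n. n \<le> M \<Longrightarrow> \<bar>\<Sum>j<n. frac (la j) - 1/2\<bar> \<le> D"
       "\<And>n. n \<le> M \<Longrightarrow> \<bar>\<Sum>j<n. frac (ua j) - 1/2\<bar> \<le> D"
       "\<And>n. n \<le> M \<Longrightarrow> \<bar>\<Sum>j<n. frac (lb j) - 1/2\<bar> \<le> D"
       "\<And>n. n \<le> M \<Longrightarrow> \<bar>\<Sum>j<n. frac (ub j) - 1/2\<bar> \<le> D"
    and N1: "\<And>j. j < n0 \<Longrightarrow> eb j \<le> ea j \<and> \<lfloor>la j\<rfloor> - \<lfloor>ub j\<rfloor> \<le> int (N j) \<and> int (N j) \<le> \<lfloor>ua j\<rfloor> - \<lfloor>lb j\<rfloor>"
    and N2: "\<And>j. n0 \<le> j \<Longrightarrow> j < M \<Longrightarrow> ea j \<le> eb j \<and> \<lfloor>lb j\<rfloor> - \<lfloor>ua j\<rfloor> \<le> int (N j) \<and> int (N j) \<le> \<lfloor>ub j\<rfloor> - \<lfloor>la j\<rfloor>"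
  shows "\<bar>real (\<Sum>j<M. N j) - (\<Sum>j<M. \<bar>eb j - ea j\<bar> / s)\<bar> \<le> 6 * D + 2 * real M * \<epsilon>"
proof -
  define \<psi> where "\<psi> x = frac x - 1/2" for x :: real
  have fl: "real_of_int \<lfloor>x\<rfloor> = x - \<psi> x - 1/2" for x by (simp add: \<psi>_def frac_def)
  define A where "A j = \<bar>eb j - ea j\<bar> / s" for j
  have one: "\<psi> (ub j) - \<psi> (la j) - 2 * \<epsilon> \<le> real (N j) - A j \<and> real (N j) - A j \<le> \<psi> (lb j) - \<psi> (ua j) + 2 * \<epsilon>"
    if "j < n0" for j
  proof -
    have A: "A j = ea j / s - eb j / s" using N1[OF that] s by (simp add: A_def diff_divide_distrib)
    have "real_of_int (\<lfloor>la j\<rfloor> - \<lfloor>ub j\<rfloor>) \<le> real_of_int (int (N j))"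
      "real_of_int (int (N j)) \<le> real_of_int (\<lfloor>ua j\<rfloor> - \<lfloor>lb j\<rfloor>)"
      using N1[OF that] by (simp_all only: of_int_le_iff)
    then show ?thesis using a[of j] b[of j] unfolding A of_int_diff of_int_of_nat_eq fl by linarith
  qed
  have two: "\<psi> (ua j) - \<psi> (lb j) - 2 * \<epsilon> \<le> real (N j) - A j \<and> real (N j) - A j \<le> \<psi> (la j) - \<psi> (ub j) + 2 * \<epsilon>"
    if "n0 \<le> j" "j < M" for j
  proof -
    have A: "A j = eb j / s - ea j / s" using N2[OF that] s by (simp add: A_def diff_divide_distrib)
    have "real_of_int (\<lfloor>lb j\<rfloor> - \<lfloor>ua j\<rfloor>) \<le> real_of_int (int (N j))"
      "real_of_int (int (N j)) \<le> real_of_int (\<lfloor>ub j\<rfloor> - \<lfloor>la j\<rfloor>)"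
      using N2[OF that] by (simp_all only: of_int_le_iff)
    then show ?thesis using a[of j] b[of j] unfolding A of_int_diff of_int_of_nat_eq fl by linarith
  qed
  define X where "X j = real (N j) - A j" for j
  have split: "sum f {..<M} = sum f {..<n0} + sum f {n0..<M}" for f :: "nat \<Rightarrow> real"
    using n0 by (metis atLeast0LessThan bot_nat_0.extremum sum.atLeastLessThan_concat)
  note Dn = D[OF n0, folded \<psi>_def]
  note DM = abs_sum_atLeastLessThan_le[OF D(1) n0, folded \<psi>_def] abs_sum_atLeastLessThan_le[OF D(2) n0, folded \<psi>_def]
    abs_sum_atLeastLessThan_le[OF D(3) n0, folded \<psi>_def] abs_sum_atLeastLessThan_le[OF D(4) n0, folded \<psi>_def]
  have M: "real n0 * (2 * \<epsilon>) + real (M - n0) * (2 * \<epsilon>) = 2 * real M * \<epsilon>"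
    using n0 by (simp add: of_nat_diff algebra_simps)
  have "sum X {..<n0} \<le> (\<Sum>j<n0. \<psi> (lb j) - \<psi> (ua j) + 2 * \<epsilon>)"
    "(\<Sum>j<n0. \<psi> (ub j) - \<psi> (la j) - 2 * \<epsilon>) \<le> sum X {..<n0}"
    "sum X {n0..<M} \<le> (\<Sum>j=n0..<M. \<psi> (la j) - \<psi> (ub j) + 2 * \<epsilon>)"
    "(\<Sum>j=n0..<M. \<psi> (ua j) - \<psi> (lb j) - 2 * \<epsilon>) \<le> sum X {n0..<M}"
    unfolding X_def using one two by (auto intro!: sum_mono)
  then have "\<bar>sum X {..<n0} + sum X {n0..<M}\<bar> \<le> 6 * D + 2 * real M * \<epsilon>"
    unfolding sum.distrib sum_subtractf sum_constant card_lessThan card_atLeastLessThan M[symmetric]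
    using Dn DM unfolding abs_le_iff by linarith
  then show ?thesis
    unfolding split[symmetric] X_def A_def by (simp add: sum_subtractf)
qed

section \<open>The grid of chords and its crossing count\<close>

context convex_body
begin

definition offsets :: "real \<Rightarrow> real \<Rightarrow> real \<Rightarrow> int set" where
  "offsets \<phi> s v = {k. meets_interior \<Omega> \<phi> (s * (of_int k + v))}"

lemma offsets_subset:
  assumes "0 < s"
  shows "offsets \<phi> s v \<subseteq> {\<lceil>- R / s - v\<rceil>..\<lfloor>R / s - v\<rfloor>}"
proof
  fix k assume "k \<in> offsets \<phi> s v"
  then obtain z where "z \<in> \<Omega>" "z \<bullet> line_dir \<phi> = s * (of_int k + v)"
    using meets_interior_imp unfolding offsets_def by blast
  then have "\<bar>s * (of_int k + v)\<bar> \<le> R" by (rule offset_le)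
  then have "- R \<le> (of_int k + v) * s" "(of_int k + v) * s \<le> R" by (auto simp: abs_le_iff mult.commute)
  then have "- R / s \<le> of_int k + v" "of_int k + v \<le> R / s"
    using assms by (simp_all only: pos_divide_le_eq pos_le_divide_eq)
  then have "- R / s - v \<le> of_int k" "of_int k \<le> R / s - v" by linarith+
  then show "k \<in> {\<lceil>- R / s - v\<rceil>..\<lfloor>R / s - v\<rfloor>}" by (simp only: ceiling_le_iff le_floor_iff atLeastAtMost_iff)
qed

lemma finite_offsets: "0 < s \<Longrightarrow> finite (offsets \<phi> s v)"
  by (rule finite_subset[OF offsets_subset]) simp_all

lemma card_offsets_le:
  assumes "0 < s"
  shows "real (card (offsets \<phi> s v)) \<le> 2 * R / s + 1"
proof -
  have "card (offsets \<phi> s v) \<le> card {\<lceil>- R / s - v\<rceil>..\<lfloor>R / s - v\<rfloor>}"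
    by (rule card_mono[OF _ offsets_subset[OF assms]]) simp
  then have "real (card (offsets \<phi> s v)) \<le> real (nat (\<lfloor>R / s - v\<rfloor> + 1 - \<lceil>- R / s - v\<rceil>))" by simp
  also have "\<dots> \<le> max 0 (R / s - v + 1 - (- R / s - v))" by linarith
  also have "\<dots> = 2 * R / s + 1" using R_nonneg assms by (simp add: max_def)
  finally show ?thesis .
qed

text \<open>Index pairs are listed instead of segments: they are visibly distinct, so counting
  crossings becomes taking cardinalities. \<open>sorted_list_of_set\<close> is meaningful here by
  \<open>finite_offsets\<close>.\<close>

definition grid_lines :: "nat \<Rightarrow> real \<Rightarrow> (nat \<Rightarrow> real) \<Rightarrow> (nat \<times> int) list" where
  "grid_lines M s v = concat (map (\<lambda>j. map (Pair j) (sorted_list_of_set (offsets (pi * j / M) s (v j)))) [0..<M])"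

definition grid_chord :: "nat \<Rightarrow> real \<Rightarrow> (nat \<Rightarrow> real) \<Rightarrow> nat \<times> int \<Rightarrow> point \<times> point" where
  "grid_chord M s v jk = chord \<Omega> (pi * fst jk / M) (s * (of_int (snd jk) + v (fst jk)))"

definition grid_chords :: "nat \<Rightarrow> real \<Rightarrow> (nat \<Rightarrow> real) \<Rightarrow> segs" where
  "grid_chords M s v = map (grid_chord M s v) (grid_lines M s v)"

lemma set_grid_lines:
  assumes "0 < s"
  shows "set (grid_lines M s v) = (SIGMA j:{..<M}. offsets (pi * j / M) s (v j))"
  using finite_offsets[OF assms] by (auto simp: grid_lines_def)

lemma distinct_grid_lines: "distinct (grid_lines M s v)"
proof -
  have "distinct (concat (map (\<lambda>j. map (Pair j) (sorted_list_of_set (A j))) [0..<M]))" for A :: "nat \<Rightarrow> int set"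
    by (induction M) (auto simp: distinct_map inj_on_def)
  then show ?thesis unfolding grid_lines_def .
qed

text \<open>Needed twice: for a crude bound on the total length, and to ensure that segments long
  enough for deletion exist.\<close>

lemma length_grid_chords_le:
  assumes "0 < s"
  shows "real (length (grid_chords M s v)) \<le> M * (2 * R / s + 1)"
proof -
  have "length (grid_chords M s v) = card (SIGMA j:{..<M}. offsets (pi * j / M) s (v j))"
    using distinct_card[OF distinct_grid_lines, of M s v] by (simp add: grid_chords_def set_grid_lines[OF assms])
  also have "\<dots> = (\<Sum>j<M. card (offsets (pi * j / M) s (v j)))"
    using finite_offsets[OF assms] by (simp add: card_SigmaI)
  finally have "real (length (grid_chords M s v)) = (\<Sum>j<M. real (card (offsets (pi * j / M) s (v j))))"
    by simp
  also have "\<dots> \<le> (\<Sum>j<M. 2 * R / s + 1)" by (intro sum_mono card_offsets_le assms)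
  finally show ?thesis by simp
qed

lemma cross_count_grid_chords:
  assumes "0 < s"
  shows "cross_count lp (grid_chords M s v)
    = (\<Sum>j<M. card {k \<in> offsets (pi * j / M) s (v j). crosses lp (grid_chord M s v (j, k))})"
proof -
  have "cross_count lp (grid_chords M s v) = length (filter (\<lambda>jk. crosses lp (grid_chord M s v jk)) (grid_lines M s v))"
    by (simp add: cross_count_def grid_chords_def filter_map o_def)
  also have "\<dots> = card (set (filter (\<lambda>jk. crosses lp (grid_chord M s v jk)) (grid_lines M s v)))"
    by (rule distinct_card[OF distinct_filter[OF distinct_grid_lines], symmetric])
  also have "set (filter (\<lambda>jk. crosses lp (grid_chord M s v jk)) (grid_lines M s v))
      = (SIGMA j:{..<M}. {k \<in> offsets (pi * j / M) s (v j). crosses lp (grid_chord M s v (j, k))})"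
    by (auto simp: set_grid_lines[OF assms])
  also have "card \<dots> = (\<Sum>j<M. card {k \<in> offsets (pi * j / M) s (v j). crosses lp (grid_chord M s v (j, k))})"
    using finite_offsets[OF assms] by (simp add: card_SigmaI)
  finally show ?thesis .
qed

lemma grid_chords_in:
  assumes "0 < s" "c \<in> set (grid_chords M s v)"
  shows "seg_set c \<subseteq> \<Omega>"
  using assms by (auto simp: grid_chords_def set_grid_lines grid_chord_def offsets_def
      intro!: chord_in meets_interior_imp dest!: subsetD[OF chord_in, rotated])

text \<open>The three errors come from the shifts, from the brackets of width
  \<open>\<epsilon>\<close>, and from summing |sin| over \<open>M\<close> angles; the last is
  multiplied by a chord length of at most \<open>2 * R\<close> and divided by
  \<open>s\<close>.\<close>

lemma cross_count_grid_bound: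
  assumes s: "0 < s" and M: "2 \<le> M" and \<theta>: "0 \<le> \<theta>" "\<theta> < pi" and meets: "meets_interior \<Omega> \<theta> p"
    and v: "\<forall>z\<in>\<Omega>. \<exists>yl yu.
      (\<forall>j. yl j < (z \<bullet> line_dir (pi * real j / M)) / s - v j \<and> (z \<bullet> line_dir (pi * real j / M)) / s - v j < yu j \<and>
         yu j - yl j = \<epsilon>) \<and>
      (\<forall>n\<le>M. \<bar>\<Sum>j<n. frac (yl j) - 1/2\<bar> \<le> D \<and> \<bar>\<Sum>j<n. frac (yu j) - 1/2\<bar> \<le> D)"
  shows "\<bar>real (cross_count (\<theta>, p) (grid_chords M s v)) - 2 * real M / (pi * s) * chord_length \<Omega> (\<theta>, p)\<bar>
    \<le> 6 * D + 2 * real M * \<epsilon> + 4 * R / (s * M)"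
proof -
  define e1 e2 where "e1 = end1 \<theta> p" and "e2 = end2 \<theta> p"
  define ea eb where "ea j = e1 \<bullet> line_dir (pi * real j / M)" and "eb j = e2 \<bullet> line_dir (pi * real j / M)" for j
  define r where "r = chord_length \<Omega> (\<theta>, p)"
  have r: "0 \<le> r" "r \<le> 2 * R" using chord_length_le by (auto simp: r_def chord_length_def)
  have diff: "eb j - ea j = r * sin (pi * real j / M - \<theta>)" for j
    unfolding ea_def eb_def r_def e1_def e2_def by (rule end_diff[OF meets])
  define N where "N j = card {k \<in> offsets (pi * j / M) s (v j). crosses (\<theta>, p) (grid_chord M s v (j, k))}" for j
  obtain la ua where a: "\<And>j. la j < ea j / s - v j \<and> ea j / s - v j < ua j \<and> ua j - la j = \<epsilon>"
    and aD: "\<And>n. n \<le> M \<Longrightarrow> \<bar>\<Sum>j<n. frac (la j) - 1/2\<bar> \<le> D \<and> \<bar>\<Sum>j<n. frac (ua j) - 1/2\<bar> \<le> D"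
    using bspec[OF v end_in(1)[OF meets]] unfolding ea_def e1_def by metis
  obtain lb ub where b: "\<And>j. lb j < eb j / s - v j \<and> eb j / s - v j < ub j \<and> ub j - lb j = \<epsilon>"
    and bD: "\<And>n. n \<le> M \<Longrightarrow> \<bar>\<Sum>j<n. frac (lb j) - 1/2\<bar> \<le> D \<and> \<bar>\<Sum>j<n. frac (ub j) - 1/2\<bar> \<le> D"
    using bspec[OF v end_in(2)[OF meets]] unfolding eb_def e2_def by metis
  have C1: "k \<in> {k \<in> offsets (pi * j / M) s (v j). crosses (\<theta>, p) (grid_chord M s v (j, k))}"
    if "min (ea j) (eb j) < s * (of_int k + v j)" "s * (of_int k + v j) < max (ea j) (eb j)" for k :: int and j
    using between_imp_crosses_chord[OF meets that[unfolded ea_def eb_def e1_def e2_def]]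
    by (auto simp: offsets_def grid_chord_def)
  have C2: "min (ea j) (eb j) \<le> s * (of_int k + v j) \<and> s * (of_int k + v j) \<le> max (ea j) (eb j)"
    if "k \<in> {k \<in> offsets (pi * j / M) s (v j). crosses (\<theta>, p) (grid_chord M s v (j, k))}" for k :: int and j
    using that crosses_chord_imp_between[OF meets meets_interior_imp]
    unfolding ea_def eb_def e1_def e2_def by (auto simp: offsets_def grid_chord_def)
  have le: "\<lfloor>lb j\<rfloor> - \<lfloor>ua j\<rfloor> \<le> int (N j) \<and> int (N j) \<le> \<lfloor>ub j\<rfloor> - \<lfloor>la j\<rfloor>" if "ea j \<le> eb j" for j
  proof -
    have mm: "min (ea j) (eb j) = ea j" "max (ea j) (eb j) = eb j" using that by auto
    show ?thesis unfolding N_def using a[of j] b[of j] C1[of j, unfolded mm] C2[of _ j, unfolded mm]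
      by (intro conjI card_between_bounds[OF s that, where v="v j"]) auto
  qed
  have ge: "\<lfloor>la j\<rfloor> - \<lfloor>ub j\<rfloor> \<le> int (N j) \<and> int (N j) \<le> \<lfloor>ua j\<rfloor> - \<lfloor>lb j\<rfloor>" if "eb j \<le> ea j" for j
  proof -
    have mm: "min (ea j) (eb j) = eb j" "max (ea j) (eb j) = ea j" using that by auto
    show ?thesis unfolding N_def using a[of j] b[of j] C1[of j, unfolded mm] C2[of _ j, unfolded mm]
      by (intro conjI card_between_bounds[OF s that, where v="v j"]) auto
  qed
  \<comment> \<open>The number of directions with angle below \<theta>. For these
    \<open>sin (pi * j / M - \<theta>)\<close> is nonpositive and for the others nonnegative, all
    angles lying in \<open>[0, pi)\<close>.\<close>
  define n0 where "n0 = min M (nat \<lceil>\<theta> * M / pi\<rceil>)"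
  have n0_iff: "j < n0 \<longleftrightarrow> pi * real j / M < \<theta>" if "j < M" for j
  proof -
    have "j < n0 \<longleftrightarrow> int j < \<lceil>\<theta> * M / pi\<rceil>" using that by (auto simp: n0_def zless_nat_eq_int_zless)
    also have "\<dots> \<longleftrightarrow> real j < \<theta> * M / pi" by (simp add: less_ceiling_iff)
    also have "\<dots> \<longleftrightarrow> pi * real j / M < \<theta>" using M by (simp add: field_simps)
    finally show ?thesis .
  qed
  have ang: "0 \<le> pi * real j / M" "pi * real j / M < pi" if "j < M" for j
    using that by (auto simp: field_simps)
  have main: "\<bar>real (\<Sum>j<M. N j) - (\<Sum>j<M. \<bar>eb j - ea j\<bar> / s)\<bar> \<le> 6 * D + 2 * real M * \<epsilon>"
  proof (rule sum_counts_bound[OF s _ a b, where ?n0.0=n0])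
    show "n0 \<le> M" by (simp add: n0_def)
    fix j assume j: "j < n0"
    then have "j < M" by (simp add: n0_def)
    then have "sin (\<theta> - pi * real j / M) \<ge> 0"
      using n0_iff[of j] j ang[of j] \<theta> by (intro sin_ge_zero) linarith+
    then have "sin (pi * real j / M - \<theta>) \<le> 0" using sin_minus[of "\<theta> - pi * real j / M"] by simp
    then have "eb j - ea j \<le> 0" unfolding diff using r by (intro mult_nonneg_nonpos)
    then show "eb j \<le> ea j \<and> \<lfloor>la j\<rfloor> - \<lfloor>ub j\<rfloor> \<le> int (N j) \<and> int (N j) \<le> \<lfloor>ua j\<rfloor> - \<lfloor>lb j\<rfloor>"
      using ge[of j] by simp
  next
    fix j assume j: "n0 \<le> j" "j < M"
    then have "sin (pi * real j / M - \<theta>) \<ge> 0"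
      using n0_iff[of j] ang[of j] \<theta> by (intro sin_ge_zero) linarith+
    then have "0 \<le> eb j - ea j" unfolding diff using r by (intro mult_nonneg_nonneg)
    then show "ea j \<le> eb j \<and> \<lfloor>lb j\<rfloor> - \<lfloor>ua j\<rfloor> \<le> int (N j) \<and> int (N j) \<le> \<lfloor>ub j\<rfloor> - \<lfloor>la j\<rfloor>"
      using le[of j] by simp
  qed (use aD bD in auto)
  have cc: "cross_count (\<theta>, p) (grid_chords M s v) = (\<Sum>j<M. N j)"
    unfolding N_def by (rule cross_count_grid_chords[OF s])
  define \<Sigma> where "\<Sigma> = (\<Sum>j<M. \<bar>sin (- \<theta> + real j * (pi / M))\<bar>)"
  have "\<bar>\<Sigma> - 2 * real M / pi\<bar> \<le> 2 / M" unfolding \<Sigma>_def by (rule sum_abs_sin_bound[OF M])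
  then have "r / s * \<bar>\<Sigma> - 2 * real M / pi\<bar> \<le> r / s * (2 / M)" using r s by (intro mult_left_mono) auto
  also have "\<dots> \<le> 2 * R / s * (2 / M)" using r s by (intro mult_right_mono divide_right_mono) auto
  finally have quad: "\<bar>r / s * \<Sigma> - r / s * (2 * real M / pi)\<bar> \<le> 4 * R / (s * M)"
  proof -
    have "r / s * \<Sigma> - r / s * (2 * real M / pi) = r / s * (\<Sigma> - 2 * real M / pi)"
      by (simp only: right_diff_distrib)
    moreover assume "r / s * \<bar>\<Sigma> - 2 * real M / pi\<bar> \<le> 2 * R / s * (2 / real M)"
    ultimately show ?thesis using r s by (simp add: abs_mult)
  qed
  have ie: "(\<Sum>j<M. \<bar>eb j - ea j\<bar> / s) = r / s * \<Sigma>"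
    unfolding diff \<Sigma>_def sum_distrib_left using r
    by (intro sum.cong) (auto simp: abs_mult mult.commute)
  have "r / s * (2 * real M / pi) = 2 * real M / (pi * s) * r" by (simp add: mult.commute)
  note quad = quad[unfolded this]
  have "\<bar>a - c\<bar> \<le> x + y" if "\<bar>a - b\<bar> \<le> x" "\<bar>b - c\<bar> \<le> y" for a b c x y :: real
    using that by linarith
  from this[OF main[unfolded ie] quad] show ?thesis unfolding cc r_def .
qed

end

subsection \<open>Shortening a system of segments\<close>

lemma cross_count_Nil [simp]: "cross_count lp [] = 0"
  by (simp add: cross_count_def)

lemma cross_count_Cons [simp]: "cross_count lp (s # S) = of_bool (crosses lp s) + cross_count lp S"
  by (simp add: cross_count_def)

lemma cross_count_append [simp]: "cross_count lp (S @ T) = cross_count lp S + cross_count lp T"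
  by (simp add: cross_count_def)

text \<open>Comparing each entry with later ones only makes the condition decompose over
  \<open>@\<close>, which suits deleting one segment or replacing it by a part of itself.\<close>

lemma nonoverlapping_iff_sorted_wrt:
  "nonoverlapping S \<longleftrightarrow> (\<forall>s\<in>set S. fst s \<noteq> snd s) \<and>
     sorted_wrt (\<lambda>s t. finite (seg_set s \<inter> seg_set t)) S"
proof -
  have "(\<forall>i<length S. \<forall>j<length S. i \<noteq> j \<longrightarrow> finite (seg_set (S!i) \<inter> seg_set (S!j)))
    \<longleftrightarrow> (\<forall>i j. i < j \<longrightarrow> j < length S \<longrightarrow> finite (seg_set (S!i) \<inter> seg_set (S!j)))"
    (is "?A \<longleftrightarrow> ?B")
  proof
    assume A: ?A
    show ?B
    proof (intro allI impI)
      fix i j assume "i < j" "j < length S"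
      then show "finite (seg_set (S!i) \<inter> seg_set (S!j))"
        using A[rule_format, of i j] by simp
    qed
  next
    assume B: ?B
    show ?A
    proof (intro allI impI)
      fix i j assume "i < length S" "j < length S" "i \<noteq> j"
      then show "finite (seg_set (S!i) \<inter> seg_set (S!j))"
        using B[rule_format, of i j] B[rule_format, of j i]
        by (cases "i < j") (auto simp: Int_commute)
    qed
  qed
  then show ?thesis unfolding nonoverlapping_def sorted_wrt_iff_nth_less by (simp add: all_set_conv_all_nth)
qed

lemma total_length_append [simp]: "total_length (S @ T) = total_length S + total_length T"
  by (simp add: total_length_def)

lemma total_length_Cons [simp]: "total_length (s # S) = dist (fst s) (snd s) + total_length S"
  by (simp add: total_length_def)

lemma total_length_Nil [simp]: "total_length [] = 0"
  by (simp add: total_length_def)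

text \<open>Removing whole segments of at least average length first, few removals are needed; only
  the last one has to be a cut.\<close>

lemma shorten_to_length:
  fixes c L :: real
  assumes "0 < c" "c * length S \<le> L" "0 < L" "L \<le> total_length S" "nonoverlapping S"
  shows "\<exists>S'. total_length S' = L \<and> nonoverlapping S' \<and> union_set S' \<subseteq> union_set S \<and>
    (\<forall>lp. \<bar>real (cross_count lp S') - real (cross_count lp S)\<bar> \<le> (total_length S - L) / c + 1)"
  using assms(2-)
proof (induction "length S" arbitrary: S rule: less_induct)
  case less
  show ?case
  proof (cases "total_length S = L")
    case True then show ?thesis using less.prems by (intro exI[of _ S]) auto
  next
    case False
    then have TL: "L < total_length S" using less.prems by simp
    \<comment> \<open>If all segments were shorter than \<open>c\<close>, the total length would be
      at most \<open>c * length S \<le> L\<close>.\<close>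
    have "\<exists>s\<in>set S. c \<le> dist (fst s) (snd s)"
    proof (rule ccontr)
      assume "\<not> ?thesis"
      then have "(\<Sum>s\<leftarrow>S. dist (fst s) (snd s)) \<le> (\<Sum>s\<leftarrow>S. c)" by (intro sum_list_mono) force
      then show False using TL less.prems by (simp add: total_length_def sum_list_triv mult.commute)
    qed
    then obtain s xs ys where S: "S = xs @ s # ys" and cs: "c \<le> dist (fst s) (snd s)"
      by (meson split_list)
    define d where "d = dist (fst s) (snd s)"
    have d: "0 < d" "c \<le> d" using cs assms(1) by (auto simp: d_def)
    define S1 where "S1 = xs @ ys"
    have T1: "total_length S = total_length S1 + d" by (simp add: S S1_def d_def)
    have cc: "cross_count lp S = cross_count lp S1 + of_bool (crosses lp s)" for lp
      by (simp add: S S1_def)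
    have no: "nonoverlapping S1"
      using less.prems(4) unfolding nonoverlapping_iff_sorted_wrt S S1_def by (auto simp: sorted_wrt_append)
    show ?thesis
    proof (cases "L \<le> total_length S1")
      case True
      have "c * real (length S1) \<le> c * real (length S)" using assms(1) by (simp add: S S1_def)
      then obtain S' where S': "total_length S' = L" "nonoverlapping S'" "union_set S' \<subseteq> union_set S1"
        and c': "\<And>lp. \<bar>real (cross_count lp S') - real (cross_count lp S1)\<bar> \<le> (total_length S1 - L) / c + 1"
        using less.hyps[of S1] less.prems True no by (auto simp: S S1_def)
      \<comment> \<open>A deletion changes each count by at most 1 and uses up at least
        \<open>c\<close> of the surplus; the remaining \<open>+ 1\<close> is reserved for the
        cut.\<close>
      have "(total_length S1 - L) / c + 1 \<le> (total_length S - L) / c"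
        unfolding T1 using d assms(1) by (simp add: field_simps)
      then have "\<bar>real (cross_count lp S') - real (cross_count lp S)\<bar> \<le> (total_length S - L) / c + 1" for lp
        using c'[of lp] unfolding cc by (cases "crosses lp s") auto
      moreover have "union_set S' \<subseteq> union_set S" using S'(3) by (auto simp: union_set_def S S1_def)
      ultimately show ?thesis using S' by blast
    next
      case F: False
      define l where "l = (L - total_length S1) / d"
      have l: "0 < l" "l < 1" using F TL T1 d by (auto simp: l_def field_simps)
      define t where "t = (fst s, (1 - l) *\<^sub>R fst s + l *\<^sub>R snd s)"
      have ts: "seg_set t \<subseteq> seg_set s"
      proof -
        have "(1 - l) *\<^sub>R fst s + l *\<^sub>R snd s \<in> closed_segment (fst s) (snd s)"
          unfolding in_segment using l by (intro exI[of _ l]) auto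
        then show ?thesis
          unfolding seg_set_def t_def fst_conv snd_conv
          by (intro closed_segment_subset convex_closed_segment) auto
      qed
      have dt: "dist (fst t) (snd t) = l * d"
      proof -
        have "fst t - snd t = l *\<^sub>R (fst s - snd s)" by (simp add: t_def algebra_simps)
        then show ?thesis using l by (simp add: dist_norm d_def)
      qed
      have "nonoverlapping (xs @ t # ys)"
      proof -
        have "fst t \<noteq> snd t" using dt l d by auto
        moreover have "finite (seg_set x \<inter> seg_set t)" if "finite (seg_set x \<inter> seg_set s)" for x
          using that ts by (meson Int_mono finite_subset order_refl)
        moreover have "finite (seg_set t \<inter> seg_set x)" if "finite (seg_set s \<inter> seg_set x)" for x
          using that ts by (meson Int_mono finite_subset order_refl)
        ultimately show ?thesis
          using less.prems(4) unfolding nonoverlapping_iff_sorted_wrt S by (auto simp: sorted_wrt_append)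
      qed
      moreover have "total_length (xs @ t # ys) = L" using dt d by (simp add: l_def S1_def)
      moreover have "union_set (xs @ t # ys) \<subseteq> union_set S" using ts by (auto simp: union_set_def S)
      moreover have "\<bar>real (cross_count lp (xs @ t # ys)) - real (cross_count lp S)\<bar> \<le> (total_length S - L) / c + 1" for lp
      proof -
        have "0 \<le> (total_length S - L) / c" using TL assms(1) by simp
        then show ?thesis by (cases "crosses lp s"; cases "crosses lp t") (auto simp: S)
      qed
      ultimately show ?thesis by blast
    qed
  qed
qed

subsection \<open>Total length from crossing counts\<close>

text \<open>The offsets of crossing lines form the open interval between the projections of the two
  ends.\<close>

lemma has_bochner_integral_crosses:
  "has_bochner_integral lborel (\<lambda>p. of_bool (crosses (\<theta>, p) s) :: real) \<bar>(snd s - fst s) \<bullet> line_dir \<theta>\<bar>"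
proof -
  define x y where "x = fst s \<bullet> line_dir \<theta>" and "y = snd s \<bullet> line_dir \<theta>"
  have "has_bochner_integral lborel (indicator {min x y<..<max x y}) (measure lborel {min x y<..<max x y})"
    by (rule has_bochner_integral_real_indicator) auto
  also have "measure lborel {min x y<..<max x y} = \<bar>(snd s - fst s) \<bullet> line_dir \<theta>\<bar>"
    by (simp add: inner_diff_left x_def y_def)
  also have "indicator {min x y<..<max x y} = (\<lambda>p. of_bool (crosses (\<theta>, p) s) :: real)"
    by (auto simp: fun_eq_iff crosses_def x_def[symmetric] y_def[symmetric] indicator_def mult_less_0_iff
        min_def max_def)
  finally show ?thesis .
qed

lemma has_bochner_integral_cross_count:
  "has_bochner_integral lborel (\<lambda>p. real (cross_count (\<theta>, p) S)) (\<Sum>s\<leftarrow>S. \<bar>(snd s - fst s) \<bullet> line_dir \<theta>\<bar>)"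
proof (induction S)
  case (Cons s S)
  then show ?case
    using has_bochner_integral_add[OF has_bochner_integral_crosses[of \<theta> s] Cons] by simp
qed (simp add: has_bochner_integral_zero)

text \<open>In polar coordinates the projected lengths of \<open>w\<close> are \<open>norm w\<close>
  times |sin| at equally spaced angles. This is Crofton's formula for one segment, with a finite sum
  for the angular integral.\<close>

lemma sum_abs_inner_line_dir_bound:
  assumes "2 \<le> M"
  shows "\<bar>(\<Sum>j<M. \<bar>w \<bullet> line_dir (pi * real j / M)\<bar>) - 2 * real M / pi * norm w\<bar> \<le> 2 / real M * norm w"
proof -
  define z where "z = Complex (fst w) (snd w)"
  have nz: "norm z = norm w" by (simp add: z_def cmod_def norm_prod_def)
  obtain \<beta> where "z = rcis (norm z) \<beta>" using rcis_cmod_Arg by metis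
  then have "fst w = norm w * cos \<beta>" "snd w = norm w * sin \<beta>"
    using nz by (auto simp: z_def rcis_def cis.ctr complex_eq_iff)
  moreover have "w \<bullet> line_dir \<phi> = fst w * cos \<phi> + snd w * sin \<phi>" for \<phi>
    by (cases w) (simp add: line_dir_def)
  ultimately have w: "w \<bullet> line_dir \<phi> = norm w * cos (\<beta> - \<phi>)" for \<phi>
    by (simp only: cos_diff) (simp add: algebra_simps)
  have "w \<bullet> line_dir \<phi> = norm w * sin ((pi / 2 - \<beta>) + \<phi>)" for \<phi>
    unfolding w cos_sin_eq by (simp add: algebra_simps)
  then have "(\<Sum>j<M. \<bar>w \<bullet> line_dir (pi * real j / M)\<bar>)
      = norm w * (\<Sum>j<M. \<bar>sin ((pi / 2 - \<beta>) + real j * (pi / M))\<bar>)"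
    unfolding sum_distrib_left by (intro sum.cong) (auto simp: abs_mult mult.commute)
  moreover have gen: "\<bar>norm w * X - k * norm w\<bar> = norm w * \<bar>X - k\<bar>" for X k :: real
  proof -
    have "norm w * X - k * norm w = norm w * (X - k)" by (simp add: algebra_simps)
    then show ?thesis by (simp add: abs_mult)
  qed
  ultimately have "\<bar>(\<Sum>j<M. \<bar>w \<bullet> line_dir (pi * real j / M)\<bar>) - 2 * real M / pi * norm w\<bar>
      = norm w * \<bar>(\<Sum>j<M. \<bar>sin ((pi / 2 - \<beta>) + real j * (pi / M))\<bar>) - 2 * real M / pi\<bar>"
    by (simp only:)
  also have "\<dots> \<le> norm w * (2 / M)"
    by (intro mult_left_mono sum_abs_sin_bound assms) simp
  finally show ?thesis by (simp add: mult.commute)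
qed

lemma (in convex_body) cross_count_no_meet:
  assumes "\<not> (\<exists>z\<in>\<Omega>. z \<bullet> line_dir \<theta> = p)" "union_set S \<subseteq> \<Omega>"
  shows "cross_count (\<theta>, p) S = 0"
proof -
  have "\<not> crosses (\<theta>, p) s" if "s \<in> set S" for s
    using crosses_imp_meets[of "(\<theta>, p)" s] assms that by (auto simp: union_set_def)
  then have "filter (crosses (\<theta>, p)) S = []" by (simp add: filter_empty_conv)
  then show ?thesis by (simp add: cross_count_def)
qed

text \<open>Crofton's formula, discretised to the directions \<open>\<pi> j / M\<close>: integrating the crossing
  count over all parallel lines recovers projected lengths, and the chord lengths integrate to
  the area, so a uniform bound on the discrepancy controls the total length.\<close>

lemma (in convex_body) total_length_near:
  fixes M :: nat and \<kappa> E :: real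
  assumes M: "2 \<le> M" and S: "union_set S \<subseteq> \<Omega>"
    and E: "\<And>\<theta> p. 0 \<le> \<theta> \<Longrightarrow> \<theta> < pi \<Longrightarrow> meets_interior \<Omega> \<theta> p \<Longrightarrow>
       \<bar>real (cross_count (\<theta>, p) S) - \<kappa> * chord_length \<Omega> (\<theta>, p)\<bar> \<le> E"
    and "0 \<le> E"
  shows "\<bar>total_length S - pi / 2 * \<kappa> * area \<Omega>\<bar> \<le> pi * R * E + pi / M\<^sup>2 * total_length S"
proof -
  have one: "\<bar>(\<Sum>s\<leftarrow>S. \<bar>(snd s - fst s) \<bullet> line_dir \<theta>\<bar>) - \<kappa> * area \<Omega>\<bar> \<le> 2 * R * E"
    if \<theta>: "0 \<le> \<theta>" "\<theta> < pi" for \<theta>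
  proof -
    define f where "f p = real (cross_count (\<theta>, p) S) - \<kappa> * chord_length \<Omega> (\<theta>, p)" for p
    have f: "has_bochner_integral lborel f ((\<Sum>s\<leftarrow>S. \<bar>(snd s - fst s) \<bullet> line_dir \<theta>\<bar>) - \<kappa> * area \<Omega>)"
      unfolding f_def
      by (intro has_bochner_integral_diff has_bochner_integral_cross_count
          has_bochner_integral_mult_right has_bochner_integral_chord_length \<theta> compact)
    have i: "integrable lborel (\<lambda>p. E * indicator {- R..R} p :: real)"
      using emeasure_lborel_Icc[of "- R" R] R_nonneg
      by (intro integrable_mult_right integrable_real_indicator) auto
    have "AE p in lborel. p \<notin> {p. (\<exists>z\<in>\<Omega>. z \<bullet> line_dir \<theta> = p) \<and> \<not> meets_interior \<Omega> \<theta> p}"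
      using finite_imp_null_set_lborel[OF finite_support_lines] by (rule AE_not_in)
    \<comment> \<open>Lines that miss \<open>\<Omega>\<close> contribute nothing, and all others
      have offset in \<open>[-R, R]\<close>; hence the factor \<open>2 * R\<close> after
      integration.\<close>
    then have ae: "AE p in lborel. \<bar>f p\<bar> \<le> E * indicator {- R..R} p"
    proof eventually_elim
      fix p assume p: "p \<notin> {p. (\<exists>z\<in>\<Omega>. z \<bullet> line_dir \<theta> = p) \<and> \<not> meets_interior \<Omega> \<theta> p}"
      show "\<bar>f p\<bar> \<le> E * indicator {- R..R} p"
      proof (cases "\<exists>z\<in>\<Omega>. z \<bullet> line_dir \<theta> = p")
        case True
        then have "\<bar>p\<bar> \<le> R" using offset_le by blast
        moreover have "\<bar>f p\<bar> \<le> E" unfolding f_def using True p by (intro E \<theta>) auto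
        ultimately show ?thesis by (auto simp: indicator_def abs_le_iff)
      next
        case False
        then show ?thesis using \<open>0 \<le> E\<close>
          by (simp add: f_def cross_count_no_meet[OF _ S] chord_length_no_meet)
      qed
    qed
    have fi: "integrable lborel f" using f by (rule integrable.intros)
    have "\<bar>integral\<^sup>L lborel f\<bar> \<le> (\<integral>p. \<bar>f p\<bar> \<partial>lborel)" by (rule integral_abs_bound)
    also have "\<dots> \<le> (\<integral>p. E * indicator {- R..R} p \<partial>lborel)"
      by (rule integral_mono_AE[OF _ i ae]) (use fi in simp)
    also have "\<dots> = 2 * R * E" using R_nonneg by simp
    finally show ?thesis using has_bochner_integral_integral_eq[OF f] by simp
  qed
  define P where "P T j = (\<Sum>s\<leftarrow>T. \<bar>(snd s - fst s) \<bullet> line_dir (pi * real j / M)\<bar>)" for T :: segs and j :: nat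
  have "\<bar>(\<Sum>j<M. P S j) - real M * (\<kappa> * area \<Omega>)\<bar> = \<bar>\<Sum>j<M. P S j - \<kappa> * area \<Omega>\<bar>"
    by (simp add: sum_subtractf)
  also have "\<dots> \<le> (\<Sum>j<M. \<bar>P S j - \<kappa> * area \<Omega>\<bar>)" by (rule sum_abs)
  also have "\<dots> \<le> (\<Sum>j<M. 2 * R * E)"
    unfolding P_def using M by (intro sum_mono one) (auto simp: field_simps)
  finally have 1: "\<bar>(\<Sum>j<M. P S j) - real M * (\<kappa> * area \<Omega>)\<bar> \<le> real M * (2 * R * E)" by simp
  have "\<bar>(\<Sum>j<M. P S j) - 2 * real M / pi * total_length S\<bar> \<le> 2 / real M * total_length S"
  proof (induction S)
    case Nil then show ?case by (simp add: total_length_def P_def)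
  next
    case (Cons s S)
    have "(\<Sum>j<M. P (s # S) j) = (\<Sum>j<M. \<bar>(snd s - fst s) \<bullet> line_dir (pi * real j / M)\<bar>) + (\<Sum>j<M. P S j)"
      by (simp add: sum.distrib P_def)
    moreover have "\<bar>(\<Sum>j<M. \<bar>(snd s - fst s) \<bullet> line_dir (pi * real j / M)\<bar>) - 2 * real M / pi * dist (fst s) (snd s)\<bar> \<le> 2 / real M * dist (fst s) (snd s)"
      unfolding dist_norm norm_minus_commute[of "fst s"] by (rule sum_abs_inner_line_dir_bound[OF M])
    moreover have "total_length (s # S) = dist (fst s) (snd s) + total_length S" by (simp add: total_length_def)
    ultimately show ?case using Cons by (simp add: distrib_left)
  qed
  with 1 have "\<bar>2 * real M / pi * total_length S - real M * (\<kappa> * area \<Omega>)\<bar> \<le> real M * (2 * R * E) + 2 / real M * total_length S"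
    unfolding abs_le_iff by linarith
  then have "pi / (2 * real M) * \<bar>2 * real M / pi * total_length S - real M * (\<kappa> * area \<Omega>)\<bar>
      \<le> pi / (2 * real M) * (real M * (2 * R * E) + 2 / real M * total_length S)"
    by (intro mult_left_mono) auto
  moreover have "pi / (2 * real M) * \<bar>2 * real M / pi * total_length S - real M * (\<kappa> * area \<Omega>)\<bar>
      = \<bar>pi / (2 * real M) * (2 * real M / pi * total_length S - real M * (\<kappa> * area \<Omega>))\<bar>"
    by (simp add: abs_mult)
  moreover have "pi / (2 * real M) * (2 * real M / pi * total_length S - real M * (\<kappa> * area \<Omega>))
      = total_length S - pi / 2 * \<kappa> * area \<Omega>"
    using M by (simp add: field_simps)
  moreover have "pi / (2 * real M) * (real M * (2 * R * E) + 2 / real M * total_length S)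
      = pi * R * E + pi / M\<^sup>2 * total_length S"
    using M by (simp add: field_simps power2_eq_square)
  ultimately show ?thesis by (simp only:)
qed

subsection \<open>The essential supremum\<close>

lemma finite_two_lines:
  assumes "sin (\<phi>' - \<phi>) \<noteq> 0"
  shows "finite {z. z \<bullet> line_dir \<phi> = q \<and> z \<bullet> line_dir \<phi>' = q'}"
proof (rule finite_subset)
  show "{z. z \<bullet> line_dir \<phi> = q \<and> z \<bullet> line_dir \<phi>' = q'}
    \<subseteq> {line_point \<phi> q ((q' - q * cos (\<phi>' - \<phi>)) / sin (\<phi>' - \<phi>))}"
  proof
    fix z assume z: "z \<in> {z. z \<bullet> line_dir \<phi> = q \<and> z \<bullet> line_dir \<phi>' = q'}"
    then obtain t where t: "z = line_point \<phi> q t" using on_line_iff by blast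
    with z have "q * cos (\<phi>' - \<phi>) + t * sin (\<phi>' - \<phi>) = q'" by (simp add: line_point_inner_line_dir)
    then have "t = (q' - q * cos (\<phi>' - \<phi>)) / sin (\<phi>' - \<phi>)" using assms by (simp add: field_simps)
    then show "z \<in> {line_point \<phi> q ((q' - q * cos (\<phi>' - \<phi>)) / sin (\<phi>' - \<phi>))}" using t by simp
  qed
qed simp

text \<open>\<open>esssup_I\<close> asks for joint measurability in angle and offset. The values are
  measures of slices of a closed set of triples (angle, offset, arclength).\<close>

lemma measurable_chord_length:
  assumes "closed \<Omega>"
  shows "chord_length \<Omega> \<in> borel_measurable lborel"
proof -
  define Q where "Q = (\<lambda>z. line_point (fst (fst z)) (snd (fst z)) (snd z)) -` \<Omega>"
  have "closed Q" unfolding Q_def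
    by (intro closed_vimage assms continuous_intros)
  then have Q: "Q \<in> sets (lborel \<Otimes>\<^sub>M lborel)" unfolding lborel_prod by simp
  have "(\<lambda>lp. measure lborel (Pair lp -` Q)) \<in> borel_measurable lborel"
    unfolding measure_def using lborel.measurable_emeasure_Pair[OF Q] by measurable
  moreover have "measure lborel (Pair lp -` Q) = chord_length \<Omega> lp" for lp
    by (cases lp) (simp add: chord_length_eq Q_def vimage_def)
  ultimately show ?thesis by simp
qed

lemma measurable_cross_count:
  "(\<lambda>lp. real (cross_count lp S)) \<in> borel_measurable lborel"
proof (induction S)
  case (Cons s S)
  have "open {lp. crosses lp s}" unfolding crosses_def line_dir_def
    by (intro open_Collect_less continuous_intros)
  then have "(indicator {lp. crosses lp s} :: _ \<Rightarrow> real) \<in> borel_measurable lborel" by simp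
  moreover have "(\<lambda>lp. real (cross_count lp (s # S))) = (\<lambda>lp. indicator {lp. crosses lp s} lp + real (cross_count lp S))"
    by (auto simp: fun_eq_iff indicator_def)
  ultimately show ?case using Cons by simp
qed simp

context convex_body
begin

text \<open>Chords of one direction lie on distinct parallel lines. Distinct directions differ by an
  angle strictly between 0 and pi, so their lines meet in one point.\<close>

lemma nonoverlapping_grid_chords:
  assumes s: "0 < s"
  shows "nonoverlapping (grid_chords M s v)"
  unfolding nonoverlapping_def
proof (intro conjI allI impI)
  define ls where "ls = grid_lines M s v"
  have len: "length (grid_chords M s v) = length ls" by (simp add: grid_chords_def ls_def)
  have nth: "grid_chords M s v ! i = grid_chord M s v (ls ! i)" if "i < length ls" for i
    using that by (simp add: grid_chords_def ls_def)
  have mem: "\<exists>j k. ls ! i = (j, k) \<and> j < M \<and> k \<in> offsets (pi * j / M) s (v j)" if "i < length ls" for i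
    using nth_mem[OF that] set_grid_lines[OF s, of M v] unfolding ls_def by auto
  show "fst (grid_chords M s v ! i) \<noteq> snd (grid_chords M s v ! i)" if "i < length (grid_chords M s v)" for i
    using mem[of i] that unfolding len
    by (auto simp: nth grid_chord_def offsets_def dest: chord_nondegenerate)
  fix i i' assume i: "i < length (grid_chords M s v)" "i' < length (grid_chords M s v)" "i \<noteq> i'"
  obtain j k j' k' where jk: "ls ! i = (j, k)" "ls ! i' = (j', k')" "j < M" "j' < M"
    using mem[of i] mem[of i'] i unfolding len by metis
  have ne: "(j, k) \<noteq> (j', k')"
    using i distinct_grid_lines[of M s v] unfolding len jk(1,2)[symmetric] ls_def by (simp add: nth_eq_iff_index_eq)
  define \<phi> \<phi>' q q' where "\<phi> = pi * real j / M" and "\<phi>' = pi * real j' / M"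
    and "q = s * (of_int k + v j)" and "q' = s * (of_int k' + v j')"
  have "seg_set (grid_chords M s v ! i) \<inter> seg_set (grid_chords M s v ! i')
      \<subseteq> {z. z \<bullet> line_dir \<phi> = q \<and> z \<bullet> line_dir \<phi>' = q'}" (is "?I \<subseteq> ?Z")
    using i jk on_chord_line unfolding len \<phi>_def \<phi>'_def q_def q'_def
    by (auto simp: nth grid_chord_def)
  moreover have "finite ?Z"
  proof (cases "j = j'")
    case True
    then have "q \<noteq> q'" using ne s by (simp add: q_def q'_def)
    then have "?Z = {}" using True by (auto simp: \<phi>_def \<phi>'_def)
    then show ?thesis by (simp only: finite.emptyI)
  next
    case False
    have "0 \<le> \<phi>" "\<phi> < pi" "0 \<le> \<phi>'" "\<phi>' < pi" "\<phi> \<noteq> \<phi>'"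
      using jk False by (auto simp: \<phi>_def \<phi>'_def field_simps)
    then have "sin (\<phi>' - \<phi>) \<noteq> 0"
      using sin_gt_zero[of "\<phi>' - \<phi>"] sin_gt_zero[of "\<phi> - \<phi>'"] sin_minus[of "\<phi> - \<phi>'"]
      by (cases "\<phi> < \<phi>'") auto
    then show ?thesis by (rule finite_two_lines)
  qed
  ultimately show "finite ?I" by (rule finite_subset)
qed

text \<open>Fubini applied to \<open>finite_support_lines\<close>. Measurability holds because the
  lines through the interior form an open set and, \<open>\<Omega>\<close> being compact, so do the
  lines that miss it.\<close>

lemma AE_meets_interior_or_misses:
  "AE lp in lborel. meets_interior \<Omega> (fst lp) (snd lp) \<or> \<not> (\<exists>z\<in>\<Omega>. z \<bullet> line_dir (fst lp) = snd lp)"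
proof -
  let ?P = "\<lambda>lp::real \<times> real. meets_interior \<Omega> (fst lp) (snd lp) \<or> \<not> (\<exists>z\<in>\<Omega>. z \<bullet> line_dir (fst lp) = snd lp)"
  have o1: "open {lp. meets_interior \<Omega> (fst lp) (snd lp)}"
  proof -
    have "{lp. meets_interior \<Omega> (fst lp) (snd lp)} = (\<Union>t. (\<lambda>lp. line_point (fst lp) (snd lp) t) -` interior \<Omega>)"
      unfolding meets_interior_def on_line_iff by blast
    also have "open \<dots>" by (intro open_UN ballI open_vimage continuous_intros) auto
    finally show ?thesis .
  qed
  have "closed {(x::point, lp::real \<times> real). x \<bullet> line_dir (fst lp) = snd lp}"
    unfolding line_dir_def case_prod_beta by (intro closed_Collect_eq continuous_intros)
  from closed_compact_projection[OF compact this]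
  have o2: "open {lp. \<not> (\<exists>z\<in>\<Omega>. z \<bullet> line_dir (fst lp) = snd lp)}"
    by (simp add: closed_def Collect_neg_eq[symmetric] Bex_def)
  have "{lp. ?P lp} \<in> sets borel"
    using open_Un[OF o1 o2] by (simp add: Collect_disj_eq)
  then have "{lp \<in> space (lborel \<Otimes>\<^sub>M lborel). ?P lp} \<in> sets (lborel \<Otimes>\<^sub>M lborel)"
    unfolding lborel_prod by simp
  moreover have "AE \<theta> in lborel. AE p in lborel. ?P (\<theta>, p)"
  proof (rule AE_I2)
    fix \<theta> :: real
    have "AE p in lborel. p \<notin> {p. (\<exists>z\<in>\<Omega>. z \<bullet> line_dir \<theta> = p) \<and> \<not> meets_interior \<Omega> \<theta> p}"
      using finite_imp_null_set_lborel[OF finite_support_lines] by (rule AE_not_in)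
    then show "AE p in lborel. ?P (\<theta>, p)" by eventually_elim auto
  qed
  ultimately have "AE lp in lborel \<Otimes>\<^sub>M lborel. ?P lp" by (rule lborel_pair.AE_pair_measure)
  then show ?thesis unfolding lborel_prod .
qed

lemma buffon_disc_le:
  assumes S: "union_set S \<subseteq> \<Omega>" and "0 \<le> E"
    and E: "\<And>\<theta> p. 0 \<le> \<theta> \<Longrightarrow> \<theta> < pi \<Longrightarrow> meets_interior \<Omega> \<theta> p \<Longrightarrow>
      \<bar>real (cross_count (\<theta>, p) S) - 2 * total_length S / (pi * area \<Omega>) * chord_length \<Omega> (\<theta>, p)\<bar> \<le> E"
  shows "buffon_disc \<Omega> S \<le> ereal E"
  unfolding buffon_disc_def
proof (rule esssup_I)
  have "chord_length \<Omega> \<in> borel_measurable lborel"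
    by (rule measurable_chord_length[OF compact_imp_closed[OF compact]])
  then have "(\<lambda>lp. ereal \<bar>real (cross_count lp S) - 2 * total_length S / (pi * area \<Omega>) * chord_length \<Omega> lp\<bar>)
      \<in> borel_measurable lborel"
    using measurable_cross_count[of S] by measurable
  then show "(\<lambda>lp. ereal \<bar>real (cross_count lp S) - 2 * total_length S / (pi * area \<Omega>) * chord_length \<Omega> lp\<bar>)
      \<in> borel_measurable line_measure"
    unfolding line_measure_def by (rule measurable_restrict_space1)
  have "AE lp in lborel. lp \<in> {0..<pi} \<times> UNIV \<longrightarrow>
     ereal \<bar>real (cross_count lp S) - 2 * total_length S / (pi * area \<Omega>) * chord_length \<Omega> lp\<bar> \<le> ereal E"
    using AE_meets_interior_or_misses
  proof eventually_elim
    case (elim lp)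
    obtain \<theta> p where lp: "lp = (\<theta>, p)" by (cases lp)
    show ?case
    proof (cases "meets_interior \<Omega> \<theta> p")
      case True
      then show ?thesis using E by (auto simp: lp)
    next
      case False
      then have no: "\<not> (\<exists>z\<in>\<Omega>. z \<bullet> line_dir \<theta> = p)" using elim by (simp add: lp)
      show ?thesis unfolding lp chord_length_no_meet[OF no] cross_count_no_meet[OF no S]
        using \<open>0 \<le> E\<close> by simp
    qed
  qed
  moreover have "{0..<pi} \<times> (UNIV :: real set) \<in> sets (lborel :: (real \<times> real) measure)"
    unfolding lborel_prod[symmetric] by (rule pair_measureI) auto
  ultimately show "AE lp in line_measure.
     ereal \<bar>real (cross_count lp S) - 2 * total_length S / (pi * area \<Omega>) * chord_length \<Omega> lp\<bar> \<le> ereal E"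
    unfolding line_measure_def by (subst AE_restrict_space_iff) auto
qed

lemma total_length_le:
  assumes "union_set S \<subseteq> \<Omega>"
  shows "total_length S \<le> 2 * R * length S"
proof -
  have "dist (fst s) (snd s) \<le> 2 * R" if "s \<in> set S" for s
  proof -
    have "fst s \<in> \<Omega>" "snd s \<in> \<Omega>" using assms that by (auto simp: union_set_def seg_set_def)
    then show ?thesis using norm_le[of "fst s"] norm_le[of "snd s"] norm_triangle_ineq4[of "fst s" "snd s"]
      by (simp add: dist_norm)
  qed
  then have "total_length S \<le> (\<Sum>s\<leftarrow>S. 2 * R)" unfolding total_length_def by (rule sum_list_mono)
  then show ?thesis by (simp add: sum_list_triv mult.commute)
qed

lemma area_pos: "0 < area \<Omega>"
proof -
  obtain z e where e: "0 < e" "ball z e \<subseteq> \<Omega>" using interior by (auto simp: mem_interior ex_in_conv[symmetric])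
  have "0 < measure lborel (ball z e)"
    using content_ball_pos[OF e(1), of z] by simp
  also have "\<dots> \<le> measure lborel \<Omega>"
  proof (rule measure_mono_fmeasurable[OF e(2)])
    show "\<Omega> \<in> fmeasurable lborel"
      using compact by (simp add: fmeasurable_compact)
  qed simp
  finally show ?thesis by (simp add: area_def)
qed

text \<open>Collects the construction with \<open>M\<close>, \<open>s\<close> and \<delta> still
  free, so that only asymptotics remain.\<close>

lemma grid_chords_exist:
  fixes M K :: nat
  assumes M: "2 \<le> M" and s: "0 < s" and \<delta>: "0 < \<delta>" and K: "2 * R / \<delta> + 1 \<le> real K"
  defines "E \<equiv> 6 * sqrt (real M * ln (4 * (2 * real K + 1)\<^sup>2)) + 2 * real M * (2 * \<delta> / s) + 4 * R / (s * M)"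
  shows "\<exists>S. nonoverlapping S \<and> union_set S \<subseteq> \<Omega> \<and> real (length S) \<le> real M * (2 * R / s + 1) \<and>
    \<bar>total_length S - real M * area \<Omega> / s\<bar> \<le> pi * R * E + pi / (real M)\<^sup>2 * total_length S \<and>
    (\<forall>\<theta> p. 0 \<le> \<theta> \<longrightarrow> \<theta> < pi \<longrightarrow> meets_interior \<Omega> \<theta> p \<longrightarrow>
      \<bar>real (cross_count (\<theta>, p) S) - 2 * real M / (pi * s) * chord_length \<Omega> (\<theta>, p)\<bar> \<le> E)"
proof -
  define D where "D = sqrt (real M * ln (4 * (2 * real K + 1)\<^sup>2))"
  obtain v where v: "\<forall>z\<in>\<Omega>. \<exists>yl yu.
      (\<forall>j. yl j < (z \<bullet> line_dir (pi * real j / M)) / s - v j \<and> (z \<bullet> line_dir (pi * real j / M)) / s - v j < yu j \<and>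
         yu j - yl j = 2 * \<delta> / s) \<and>
      (\<forall>n\<le>M. \<bar>\<Sum>j<n. frac (yl j) - 1/2\<bar> \<le> D \<and> \<bar>\<Sum>j<n. frac (yu j) - 1/2\<bar> \<le> D)"
    using low_discrepancy_shifts[of \<Omega> R s \<delta> M K "\<lambda>j. pi * real j / M", folded D_def] norm_le s \<delta> M K
    by auto
  define S where "S = grid_chords M s v"
  have E: "\<bar>real (cross_count (\<theta>, p) S) - 2 * real M / (pi * s) * chord_length \<Omega> (\<theta>, p)\<bar> \<le> E"
    if "0 \<le> \<theta>" "\<theta> < pi" "meets_interior \<Omega> \<theta> p" for \<theta> p
    using cross_count_grid_bound[OF s M that v] unfolding S_def E_def D_def .
  have sub: "union_set S \<subseteq> \<Omega>" using grid_chords_in[OF s] unfolding union_set_def S_def by blast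
  have "0 \<le> E" unfolding E_def
    using s \<delta> R_nonneg by (intro add_nonneg_nonneg mult_nonneg_nonneg divide_nonneg_nonneg real_sqrt_ge_zero ln_ge_zero) 
      (auto simp: power2_eq_square algebra_simps)
  \<comment> \<open>For the coefficient \<open>2 * M / (pi * s)\<close> of the chord length, the
    predicted total length is \<open>M * area \<Omega> / s\<close>.\<close>
  from total_length_near[OF M sub E this]
  have "\<bar>total_length S - real M * area \<Omega> / s\<bar> \<le> pi * R * E + pi / (real M)\<^sup>2 * total_length S"
    by simp
  then show ?thesis
    using E sub nonoverlapping_grid_chords[OF s] length_grid_chords_le[OF s] unfolding S_def by blast
qed

end

subsection \<open>Choice of parameters\<close>

text \<open>The first two conditions give \<open>2 \<le> M\<close> and \<open>M \<le> L\<close>; the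
  third lets additive constants be absorbed, the fourth keeps the intended length below
  \<open>2 * L\<close>, and the last bounds the logarithm of the net size by
  \<open>4 * ln L\<close>.\<close>

lemma eventually_parameters:
  fixes R c :: real
  assumes "0 < R" "0 < c"
  shows "\<forall>\<^sub>F L::real in at_top. 2 \<le> L powr (2/5) * ln L powr (-1/5) \<and>
     L powr (2/5) * ln L powr (-1/5) + 1 \<le> L \<and>
     1 \<le> L powr (1/5) * ln L powr (2/5) \<and>
     c * (L powr (1/5) * ln L powr (2/5)) \<le> L \<and>
     1 < L \<and> 1 < ln L \<and>
     4 * (2 * (2 * R * L + 2) + 1)\<^sup>2 \<le> L ^ 4"
  by (intro eventually_conj; use assms in real_asymp)

lemma (in convex_body) good_segments_of_length:
  assumes R: "0 < R"
  shows "\<exists>C. \<forall>\<^sub>F L in at_top. \<exists>S. union_set S \<subseteq> \<Omega> \<and> nonoverlapping S \<and> total_length S = L \<and>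
     buffon_disc \<Omega> S \<le> ereal (C * (L powr (1/5) * ln L powr (2/5)))"
proof -
  define a where "a = area \<Omega>"
  have a: "0 < a" unfolding a_def by (rule area_pos)
  \<comment> \<open>\<open>c0\<close> collects the errors in \<open>E\<close>: 18 = 6 * 3 from the
    shifts, \<open>8 / a\<close> from the brackets, \<open>8 * R / a\<close> from the angular sum.
    \<open>c2 * L\<close> bounds the number of segments.\<close>
  define c0 c2 where "c0 = 18 + 8 / a + 8 * R / a" and "c2 = 4 * R / a + 1"
  \<comment> \<open>Constant of the length error: the crossing error integrated over lines, plus the
    relative error pi / M^2 of the discretised Crofton formula times the crude length bound
    \<open>2 * R * c2 * L\<close>.\<close>
  define c1 where "c1 = pi * R * c0 + 2 * pi * R * c2"
  \<comment> \<open>Deletion accounts for \<open>2 * c1 * c2 + 1\<close>, the grid for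
    \<open>c0\<close>, and the last term for passing from \<open>L1\<close> to \<open>L\<close> in
    the coefficient of the chord length.\<close>
  define C where "C = 2 * c1 * c2 + 1 + c0 + 4 * R * c1 / (pi * a)"
  have pos: "0 < c0" "0 < c2" using a R by (auto simp: c0_def c2_def intro!: add_pos_pos)
  then have c1: "0 < c1" using R by (auto simp: c1_def intro!: add_pos_pos)
  have "\<exists>S. union_set S \<subseteq> \<Omega> \<and> nonoverlapping S \<and> total_length S = L \<and>
     buffon_disc \<Omega> S \<le> ereal (C * (L powr (1/5) * ln L powr (2/5)))"
    if H: "2 \<le> L powr (2/5) * ln L powr (-1/5) \<and>
     L powr (2/5) * ln L powr (-1/5) + 1 \<le> L \<and>
     1 \<le> L powr (1/5) * ln L powr (2/5) \<and>
     c1 * (L powr (1/5) * ln L powr (2/5)) \<le> L \<and>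
     1 < L \<and> 1 < ln L \<and>
     4 * (2 * (2 * R * L + 2) + 1)\<^sup>2 \<le> L ^ 4" for L
  proof -
    \<comment> \<open>\<open>X\<close> is the target order and \<open>Y\<close> the number of
      directions before rounding. They solve \<open>X = L / Y^2\<close> and
      \<open>X^2 = Y * ln L\<close>, which equates the two competing errors.\<close>
    define X Y where "X = L powr (1/5) * ln L powr (2/5)" and "Y = L powr (2/5) * ln L powr (-1/5)"
    have Y: "2 \<le> Y" "Y + 1 \<le> L" and X: "1 \<le> X" "c1 * X \<le> L" and L: "1 < L" "1 < ln L"
      using H by (auto simp: X_def Y_def)
    have XY: "X * Y\<^sup>2 = L" "X\<^sup>2 = Y * ln L"
    proof -
      have "X * Y\<^sup>2 = (L powr (1/5) * L powr (2/5) * L powr (2/5)) *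
          (ln L powr (2/5) * ln L powr (-1/5) * ln L powr (-1/5))"
        by (simp add: X_def Y_def power2_eq_square)
      also have "\<dots> = L" unfolding powr_add[symmetric] using L by simp
      finally show "X * Y\<^sup>2 = L" .
      have "X\<^sup>2 = (L powr (1/5) * L powr (1/5)) * (ln L powr (2/5) * ln L powr (2/5))"
        by (simp add: X_def power2_eq_square)
      also have "\<dots> = L powr (2/5) * (ln L powr (-1/5) * ln L powr 1)"
        unfolding powr_add[symmetric] by simp
      finally show "X\<^sup>2 = Y * ln L" using L by (simp add: Y_def)
    qed
    define M where "M = nat \<lceil>Y\<rceil>"
    have M: "2 \<le> M" "Y \<le> real M" "real M \<le> 2 * Y" "real M \<le> L" using Y by (auto simp: M_def) linarith+
    have LM: "L / (real M)\<^sup>2 \<le> X"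
    proof -
      have "X * Y\<^sup>2 \<le> X * (real M)\<^sup>2" using M Y X by (intro mult_left_mono power_mono) auto
      then show ?thesis using M XY by (simp add: divide_le_eq)
    qed
    have Mln: "real M * ln L \<le> 2 * X\<^sup>2"
      using M(3) L mult_right_mono[of "real M" "2 * Y" "ln L"] XY(2) by simp
    \<comment> \<open>Aiming above \<open>L\<close> by the length error guarantees that the grid is
      at least \<open>L\<close> long.\<close>
    define L1 where "L1 = L + c1 * X"
    have L1: "L \<le> L1" "L1 \<le> 2 * L" "0 < L1" using X c1 L by (auto simp: L1_def intro!: mult_nonneg_nonneg add_pos_nonneg)
    define s where "s = real M * a / L1"
    have s: "0 < s" using M a L1 by (simp add: s_def)
    define K where "K = nat \<lceil>2 * R * L + 1\<rceil>"
    have "0 \<le> 2 * R * L + 1" using R L by simp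
    then have K: "2 * R * L + 1 \<le> real K" "real K \<le> 2 * R * L + 2" unfolding K_def by linarith+
    \<comment> \<open>\<delta> is taken as \<open>1 / L\<close>: the bracket error is then bounded,
      and the net is still polynomial in \<open>L\<close>.\<close>
    define E where "E = 6 * sqrt (real M * ln (4 * (2 * real K + 1)\<^sup>2)) + 2 * real M * (2 * (1 / L) / s) + 4 * R / (s * M)"
    have "2 * R / (1 / L) + 1 \<le> real K" using K by simp
    from grid_chords_exist[OF M(1) s _ this, folded E_def] L
    obtain S where S: "nonoverlapping S" "union_set S \<subseteq> \<Omega>" "real (length S) \<le> real M * (2 * R / s + 1)"
      and T: "\<bar>total_length S - real M * a / s\<bar> \<le> pi * R * E + pi / (real M)\<^sup>2 * total_length S"
      and cc: "\<And>\<theta> p. 0 \<le> \<theta> \<Longrightarrow> \<theta> < pi \<Longrightarrow> meets_interior \<Omega> \<theta> p \<Longrightarrow>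
        \<bar>real (cross_count (\<theta>, p) S) - 2 * real M / (pi * s) * chord_length \<Omega> (\<theta>, p)\<bar> \<le> E"
      unfolding a_def by auto
    have E: "E \<le> c0 * X"
    proof -
      have "4 * (2 * real K + 1)\<^sup>2 \<le> 4 * (2 * (2 * R * L + 2) + 1)\<^sup>2"
        using K by (intro mult_left_mono power_mono) auto
      also have "\<dots> \<le> L ^ 4" using H by blast
      finally have "ln (4 * (2 * real K + 1)\<^sup>2) \<le> ln (L ^ 4)"
        by (intro ln_mono) (auto intro!: mult_pos_pos zero_less_power add_nonneg_pos)
      also have "ln (L ^ 4) = 4 * ln L" using L by (simp add: ln_realpow)
      finally have "real M * ln (4 * (2 * real K + 1)\<^sup>2) \<le> real M * (4 * ln L)" by (intro mult_left_mono) auto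
      also have "\<dots> \<le> 8 * X\<^sup>2" using Mln by simp
      also have "\<dots> \<le> (3 * X)\<^sup>2" by (simp add: power_mult_distrib)
      finally have 1: "sqrt (real M * ln (4 * (2 * real K + 1)\<^sup>2)) \<le> 3 * X"
        using X by (intro real_le_lsqrt) auto
      have "2 * real M * (2 * (1 / L) / s) = 4 / a * (L1 / L)"
        using M a L1 by (simp add: s_def)
      also have "\<dots> \<le> 4 / a * (2 * X)"
      proof (rule mult_left_mono)
        have "L1 / L \<le> 2" using L1 L by (simp add: divide_le_eq)
        then show "L1 / L \<le> 2 * X" using X by simp
      qed (use a in simp)
      finally have 2: "2 * real M * (2 * (1 / L) / s) \<le> 8 / a * X" by simp
      have "4 * R / (s * M) = 4 * R / a * (L1 / (real M)\<^sup>2)"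
        using M a L1 by (simp add: s_def power2_eq_square)
      also have "\<dots> \<le> 4 * R / a * (2 * X)"
      proof (rule mult_left_mono)
        have "L1 / (real M)\<^sup>2 \<le> 2 * L / (real M)\<^sup>2" using L1 by (intro divide_right_mono) auto
        then show "L1 / (real M)\<^sup>2 \<le> 2 * X" using LM by simp
      qed (use a R in simp)
      finally have 3: "4 * R / (s * M) \<le> 8 * R / a * X" by simp
      show ?thesis using 1 2 3 unfolding E_def c0_def by (simp add: algebra_simps)
    qed
    have n: "real (length S) \<le> c2 * L"
    proof -
      have "real M * (2 * R / s + 1) = 2 * R / a * L1 + real M" using M a L1 by (simp add: s_def field_simps)
      also have "\<dots> \<le> 2 * R / a * (2 * L) + L" using M L1 R a by (intro add_mono mult_left_mono) auto
      also have "\<dots> = c2 * L" by (simp add: c2_def algebra_simps)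
      finally show ?thesis using S(3) by linarith
    qed
    have TL1: "\<bar>total_length S - L1\<bar> \<le> c1 * X"
    proof -
      have "total_length S \<le> 2 * R * (c2 * L)"
        by (rule order_trans[OF total_length_le[OF S(2)] mult_left_mono[OF n]]) (use R in simp)
      then have "pi / (real M)\<^sup>2 * total_length S \<le> pi / (real M)\<^sup>2 * (2 * R * (c2 * L))"
        by (intro mult_left_mono) auto
      also have "\<dots> = 2 * pi * R * c2 * (L / (real M)\<^sup>2)" by simp
      also have "\<dots> \<le> 2 * pi * R * c2 * X" using LM R pos by (intro mult_left_mono) auto
      finally have "pi / (real M)\<^sup>2 * total_length S \<le> 2 * pi * R * c2 * X" .
      moreover have "pi * R * E \<le> pi * R * (c0 * X)" using E R by (intro mult_left_mono) auto
      moreover have "real M * a / s = L1" using M a L1 by (simp add: s_def)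
      ultimately show ?thesis using T by (simp add: c1_def algebra_simps)
    qed
    then have T: "L \<le> total_length S" "total_length S - L \<le> 2 * c1 * X"
      unfolding L1_def abs_le_iff by linarith+
    \<comment> \<open>So \<open>1 / c2\<close> can serve as the minimal length of deleted segments;
      a surplus of at most \<open>2 * c1 * X\<close> then costs at most
      \<open>2 * c1 * c2 * X + 1\<close> crossings.\<close>
    have "1 / c2 * length S \<le> L" using n pos by (simp add: field_simps)
    from shorten_to_length[OF _ this _ T(1) S(1)] pos L
    obtain S' where S': "total_length S' = L" "nonoverlapping S'" "union_set S' \<subseteq> union_set S"
      and cc': "\<And>lp. \<bar>real (cross_count lp S') - real (cross_count lp S)\<bar> \<le> (total_length S - L) / (1 / c2) + 1"
      by auto
    have sub: "union_set S' \<subseteq> \<Omega>" using S' S by blast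
    have "buffon_disc \<Omega> S' \<le> ereal (C * X)"
    proof (rule buffon_disc_le[OF sub])
      have "0 \<le> C" using pos c1 a R by (auto simp: C_def intro!: add_nonneg_nonneg mult_nonneg_nonneg)
      then show "0 \<le> C * X" using X by simp
      fix \<theta> p assume tp: "0 \<le> \<theta>" "\<theta> < pi" "meets_interior \<Omega> \<theta> p"
      define r where "r = chord_length \<Omega> (\<theta>, p)"
      have r: "0 \<le> r" "r \<le> 2 * R" using chord_length_le by (auto simp: r_def chord_length_def)
      have "(total_length S - L) * c2 \<le> 2 * c1 * X * c2" using T pos by (intro mult_right_mono) auto
      then have 1: "\<bar>real (cross_count (\<theta>, p) S') - real (cross_count (\<theta>, p) S)\<bar> \<le> 2 * c1 * c2 * X + 1"
        using cc'[of "(\<theta>, p)"] by (simp add: algebra_simps)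
      have 2: "\<bar>real (cross_count (\<theta>, p) S) - 2 * L1 / (pi * a) * r\<bar> \<le> c0 * X"
      proof -
        have "2 * real M / (pi * s) = 2 * L1 / (pi * a)" using M a L1 by (simp add: s_def)
        then show ?thesis using cc[OF tp] E unfolding r_def by simp
      qed
      have "2 * L1 / (pi * a) * r - 2 * L / (pi * a) * r = 2 * c1 * X / (pi * a) * r"
        by (simp add: L1_def algebra_simps add_divide_distrib)
      also have "\<dots> \<le> 2 * c1 * X / (pi * a) * (2 * R)" using r c1 X a by (intro mult_left_mono) auto
      also have "\<dots> = 4 * R * c1 / (pi * a) * X" by simp
      finally have 3: "2 * L1 / (pi * a) * r - 2 * L / (pi * a) * r \<le> 4 * R * c1 / (pi * a) * X" .
      have 4: "2 * L / (pi * a) * r \<le> 2 * L1 / (pi * a) * r"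
        using L1 r a by (intro mult_right_mono divide_right_mono) auto
      have CX: "C * X = 2 * c1 * c2 * X + X + c0 * X + 4 * R * c1 / (pi * a) * X"
        by (simp add: C_def algebra_simps)
      have "\<bar>m - z\<bar> \<le> e1 + x + e2 + e3"
        if "\<bar>m - n\<bar> \<le> e1 + 1" "\<bar>n - y\<bar> \<le> e2" "y - z \<le> e3" "z \<le> y" "1 \<le> x" for m n x y z e1 e2 e3 :: real
        using that by linarith
      from this[OF 1 2 3 4 X(1)]
      show "\<bar>real (cross_count (\<theta>, p) S') - 2 * total_length S' / (pi * area \<Omega>) * chord_length \<Omega> (\<theta>, p)\<bar> \<le> C * X"
        unfolding S'(1) a_def[symmetric] r_def[symmetric] CX .
    qed
    then show ?thesis using S' sub unfolding X_def by blast
  qed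
  then have "\<forall>\<^sub>F L in at_top. \<exists>S. union_set S \<subseteq> \<Omega> \<and> nonoverlapping S \<and> total_length S = L \<and>
     buffon_disc \<Omega> S \<le> ereal (C * (L powr (1/5) * ln L powr (2/5)))"
    by (rule eventually_mono[OF eventually_parameters[OF R c1]])
  then show ?thesis by blast
qed

theorem theorem1:
  fixes \<Omega> :: "(real \<times> real) set"
  assumes "compact \<Omega>" "convex \<Omega>" "interior \<Omega> \<noteq> {}"
  shows "\<exists>C::real. \<exists>L0::real. \<forall>L\<ge>L0. \<exists>S::segs.
           union_set S \<subseteq> \<Omega> \<and> nonoverlapping S \<and> total_length S = L \<and>
           buffon_disc \<Omega> S \<le> ereal (C * L powr (1/5) * (ln L) powr (2/5))"
proof -
  obtain R where R: "0 < R" "\<And>z. z \<in> \<Omega> \<Longrightarrow> norm z \<le> R"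
    using compact_imp_bounded[OF assms(1)] by (auto simp: bounded_pos)
  interpret convex_body \<Omega> R by unfold_locales (use assms R in auto)
  show ?thesis
    using good_segments_of_length[OF R(1)] by (simp add: eventually_at_top_linorder mult.assoc)
qed

end
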